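(* Let $\lambda$ be a highest weight of $sl_3$, $V_\lambda$ the irreducible representation with Gelfand--Tsetlin basis $(\xi_\Lambda)_{\Lambda\in\mathcal P_\lambda}$, let $S=(S_{ij})\in SO(3)$, let $\sigma$ be the operator on $V_\lambda$ representing $S^{-1}$, and write $\sigma\,\xi_\Lambda=\sum_{\Lambda'}\sigma_{\Lambda',\Lambda}\xi_{\Lambda'}$, with $\sigma_{\Lambda',\Lambda}:=0$ whenever $\Lambda$ or $\Lambda'$ is not in $\mathcal P_\lambda$ (terms containing such a factor are omitted). Then the $\sigma_{\Lambda',\Lambda}$ satisfy recurrence relations in $\Lambda$ and difference relations in $\Lambda'$, obtained by taking matrix elements of $$\sigma\,\Psi_S(g)\,\xi_\Lambda=g\,\sigma\,\xi_\Lambda\quad\text{(recurrence)},\qquad \sigma\,g\,\xi_\Lambda=\Psi_{S^t}(g)\,\sigma\,\xi_\Lambda\quad\text{(difference)}$$ for $g=H,Y,J$, which act diagonally: $H\xi_\Lambda=(2\lambda_{11}-\lambda_{21}-\lambda_{22})\xi_\Lambda$, $Y\xi_\Lambda=(\lambda_{21}+\lambda_{22})\xi_\Lambda$, $J\xi_\Lambda=\frac14(\lambda_{21}-\lambda_{22})(\lambda_{21}-\lambda_{22}+2)\xi_\Lambda$. Explicitly, for $g=H$ and all $\Lambda=(\lambda_{11},\lambda_{21},\lambda_{22}),\Lambda'=(\lambda'_{11},\lambda'_{21},\lambda'_{22})\in\mathcal P_\lambda$, the recurrence relation is $$\begin{aligned} &\Big((S_{11}^2-S_{12}^2)\lambda_{11}+(S_{21}^2-S_{22}^2)(\lambda_{21}+\lambda_{22}-\lambda_{11})-(S_{31}^2-S_{32}^2)(\lambda_{21}+\lambda_{22})\Big)\sigma_{\Lambda',\Lambda}\\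 &+(S_{11}S_{21}-S_{12}S_{22})\Big((\lambda_{21}-\lambda_{11})(\lambda_{11}-\lambda_{22}+1)\sigma_{\Lambda',\Lambda+\delta^{11}}+\sigma_{\Lambda',\Lambda-\delta^{11}}\Big)\\ &+(S_{21}S_{31}-S_{22}S_{32})\Big(\tfrac{\lambda_{31}-\lambda_{21}}{\lambda_{21}-\lambda_{22}+1}\sigma_{\Lambda',\Lambda+\delta^{21}}+\tfrac{\lambda_{31}-\lambda_{22}+1}{\lambda_{21}-\lambda_{22}+1}\sigma_{\Lambda',\Lambda+\delta^{22}}\Big)\\ &+(S_{31}S_{21}-S_{32}S_{22})\Big(\tfrac{(\lambda_{21}-\lambda_{32})(\lambda_{21}-\lambda_{33}+1)(\lambda_{21}-\lambda_{11})}{\lambda_{21}-\lambda_{22}+1}\sigma_{\Lambda',\Lambda-\delta^{21}}+\tfrac{(\lambda_{11}-\lambda_{22}+1)(\lambda_{32}-\lambda_{22}+1)(\lambda_{22}-\lambda_{33})}{\lambda_{21}-\lambda_{22}+1}\sigma_{\Lambda',\Lambda-\delta^{22}}\Big)\\ &+(S_{11}S_{31}-S_{12}S_{32})\Big(\tfrac{(\lambda_{11}-\lambda_{22}+1)(\lambda_{31}-\lambda_{21})}{\lambda_{21}-\lambda_{22}+1}\sigma_{\Lambda',\Lambda+\delta^{11}+\delta^{21}}-\tfrac{(\lambda_{21}-\lambda_{11})(\lambda_{31}-\lambda_{22}+1)}{\lambda_{21}-\lambda_{22}+1}\sigma_{\Lambda',\Lambda+\delta^{11}+\delta^{22}}\Big)\\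 &+(S_{31}S_{11}-S_{32}S_{12})\Big(\tfrac{(\lambda_{21}-\lambda_{32})(\lambda_{21}-\lambda_{33}+1)}{\lambda_{21}-\lambda_{22}+1}\sigma_{\Lambda',\Lambda-\delta^{11}-\delta^{21}}-\tfrac{(\lambda_{32}-\lambda_{22}+1)(\lambda_{22}-\lambda_{33})}{\lambda_{21}-\lambda_{22}+1}\sigma_{\Lambda',\Lambda-\delta^{11}-\delta^{22}}\Big)\\ &=(2\lambda'_{11}-\lambda'_{21}-\lambda'_{22})\,\sigma_{\Lambda',\Lambda}, \end{aligned}$$ and the difference relation is $$\begin{aligned} &(2\lambda_{11}-\lambda_{21}-\lambda_{22})\,\sigma_{\Lambda',\Lambda}=\\ &\Big((S_{11}^2-S_{21}^2)\lambda'_{11}+(S_{12}^2-S_{22}^2)(\lambda'_{21}+\lambda'_{22}-\lambda'_{11})-(S_{13}^2-S_{23}^2)(\lambda'_{21}+\lambda'_{22})\Big)\sigma_{\Lambda',\Lambda}\\ &+(S_{11}S_{12}-S_{21}S_{22})\Big((\lambda'_{21}-\lambda'_{11}+1)(\lambda'_{11}-\lambda'_{22})\sigma_{\Lambda'-\delta^{11},\Lambda}+\sigma_{\Lambda'+\delta^{11},\Lambda}\Big)\\ &+(S_{12}S_{13}-S_{22}S_{23})\Big(\tfrac{\lambda_{31}-\lambda'_{21}+1}{\lambda'_{21}-\lambda'_{22}}\sigma_{\Lambda'-\delta^{21},\Lambda}+\tfrac{\lambda_{31}-\lambda'_{22}+2}{\lambda'_{21}-\lambda'_{22}+2}\sigma_{\Lambda'-\delta^{22},\Lambda}\Big)\\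 &+(S_{13}S_{12}-S_{23}S_{22})\Big(\tfrac{(\lambda'_{21}-\lambda_{32}+1)(\lambda'_{21}-\lambda_{33}+2)(\lambda'_{21}-\lambda'_{11}+1)}{\lambda'_{21}-\lambda'_{22}+2}\sigma_{\Lambda'+\delta^{21},\Lambda}+\tfrac{(\lambda'_{11}-\lambda'_{22})(\lambda_{32}-\lambda'_{22})(\lambda'_{22}-\lambda_{33}+1)}{\lambda'_{21}-\lambda'_{22}}\sigma_{\Lambda'+\delta^{22},\Lambda}\Big)\\ &+(S_{11}S_{13}-S_{21}S_{23})\Big(\tfrac{(\lambda'_{11}-\lambda'_{22})(\lambda_{31}-\lambda'_{21}+1)}{\lambda'_{21}-\lambda'_{22}}\sigma_{\Lambda'-\delta^{11}-\delta^{21},\Lambda}-\tfrac{(\lambda'_{21}-\lambda'_{11}+1)(\lambda_{31}-\lambda'_{22}+2)}{\lambda'_{21}-\lambda'_{22}+2}\sigma_{\Lambda'-\delta^{11}-\delta^{22},\Lambda}\Big)\\ &+(S_{13}S_{11}-S_{23}S_{21})\Big(\tfrac{(\lambda'_{21}-\lambda_{32}+1)(\lambda'_{21}-\lambda_{33}+2)}{\lambda'_{21}-\lambda'_{22}+2}\sigma_{\Lambda'+\delta^{11}+\delta^{21},\Lambda}-\tfrac{(\lambda_{32}-\lambda'_{22})(\lambda'_{22}-\lambda_{33}+1)}{\lambda'_{21}-\lambda'_{22}}\sigma_{\Lambda'+\delta^{11}+\delta^{22},\Lambda}\Big). \end{aligned}$$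
   Context: **Representation.** $sl_3$ is the complex Lie algebra of traceless $3\times3$ matrices; $e_{ij}=E_{ij}-\frac{\delta_{ij}}{3}I$ for $1\le i,j\le 3$, with $E_{ij}$ the matrix units. A highest weight is $\lambda=(\lambda_{31},\lambda_{32},\lambda_{33})$ with $\lambda_{31}-\lambda_{32},\lambda_{32}-\lambda_{33}\in\mathbb Z_{\ge0}$ and $\lambda_{31}+\lambda_{32}+\lambda_{33}=0$. The set $\mathcal P_\lambda$ of Gelfand--Tsetlin (GT) patterns consists of the triples $\Lambda=(\lambda_{11},\lambda_{21},\lambda_{22})$ such that $\lambda_{31}-\lambda_{21}$, $\lambda_{21}-\lambda_{32}$, $\lambda_{32}-\lambda_{22}$, $\lambda_{22}-\lambda_{33}$, $\lambda_{21}-\lambda_{11}$, $\lambda_{11}-\lambda_{22}$ all lie in $\mathbb Z_{\ge0}$. $V_\lambda$ is the irreducible $sl_3$-module with basis $(\xi_\Lambda)_{\Lambda\in\mathcal P_\lambda}$ and action $e_{11}\xi_\Lambda=\lambda_{11}\xi_\Lambda$, $e_{22}\xi_\Lambda=(\lambda_{21}+\lambda_{22}-\lambda_{11})\xi_\Lambda$, $e_{33}\xi_\Lambda=-(\lambda_{21}+\lambda_{22})\xi_\Lambda$, $e_{12}\xi_\Lambda=(\lambda_{21}-\lambda_{11})(\lambda_{11}-\lambda_{22}+1)\xi_{\Lambda+\delta^{11}}$, $e_{21}\xi_\Lambda=\xi_{\Lambda-\delta^{11}}$, $e_{23}\xi_\Lambda=\frac{\lambda_{31}-\lambda_{21}}{\lambda_{21}-\lambda_{22}+1}\xi_{\Lambda+\delta^{21}}+\frac{\lambda_{31}-\lambda_{22}+1}{\lambda_{21}-\lambda_{22}+1}\xi_{\Lambda+\delta^{22}}$,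 $e_{32}\xi_\Lambda=\frac{(\lambda_{21}-\lambda_{32})(\lambda_{21}-\lambda_{33}+1)(\lambda_{21}-\lambda_{11})}{\lambda_{21}-\lambda_{22}+1}\xi_{\Lambda-\delta^{21}}+\frac{(\lambda_{11}-\lambda_{22}+1)(\lambda_{32}-\lambda_{22}+1)(\lambda_{22}-\lambda_{33})}{\lambda_{21}-\lambda_{22}+1}\xi_{\Lambda-\delta^{22}}$, $e_{13}=[e_{12},e_{23}]$, $e_{31}=[e_{32},e_{21}]$, where $\Lambda\pm\delta^{ij}$ means $\lambda_{ij}$ replaced by $\lambda_{ij}\pm1$ and $\xi_{\Lambda\pm\delta^{ij}}=0$ if the result is not in $\mathcal P_\lambda$. **Rotations.** $V_\lambda$ integrates to a representation $\pi$ of $SL_3(\mathbb C)\supset SO(3)$; the operator representing $S^{-1}$ is $\sigma=\pi(S^{-1})$. For $R\in SO(3)$, $\Psi_R$ is the automorphism of $U(sl_3)$ extending $g\mapsto RgR^{-1}$ on $sl_3$, i.e. $\Psi_R(e_{ij})=\sum_{k,\ell}R_{ki}R_{\ell j}e_{k\ell}$. $S^t$ is the transpose of $S$. **Elements.** $H=e_{11}-e_{22}$, $Y=\frac13(e_{11}+e_{22}-2e_{33})$, $J=\frac{(e_{11}-e_{22})^2+2(e_{11}-e_{22})}{4}+e_{21}e_{12}\in U(sl_3)$. *)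

theory Defs
  imports "HOL-Analysis.Analysis" "HOL-Library.Function_Algebras" "HOL-Library.Poly_Mapping"
begin

section \<open>The Lie algebra of traceless complex matrices\<close>

typedef sl3 = "{A :: complex^3^3. trace A = 0}"
  morphisms mat_of_sl3 sl3_of_mat
  by (rule exI[of _ 0]) (simp add: trace_def)

setup_lifting type_definition_sl3

instantiation sl3 :: ab_group_add
begin
lift_definition zero_sl3 :: sl3 is 0 by (simp add: trace_def)
lift_definition plus_sl3 :: "sl3 \<Rightarrow> sl3 \<Rightarrow> sl3" is "(+)" by (simp add: trace_add)
lift_definition minus_sl3 :: "sl3 \<Rightarrow> sl3 \<Rightarrow> sl3" is "(-)" by (simp add: trace_sub)
lift_definition uminus_sl3 :: "sl3 \<Rightarrow> sl3" is uminus by (simp add: trace_def sum_negf)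
instance by standard (transfer; simp)+
end

lift_definition sl3_scale :: "complex \<Rightarrow> sl3 \<Rightarrow> sl3" is "\<lambda>c A. \<chi> i j. c * A $ i $ j"
  by (simp add: trace_def flip: sum_distrib_left)

lift_definition sl3_bracket :: "sl3 \<Rightarrow> sl3 \<Rightarrow> sl3" is "\<lambda>A B. A ** B - B ** A"
  by (metis trace_sub trace_mul_sym diff_self)

definition mat_unit :: "3 \<Rightarrow> 3 \<Rightarrow> complex^3^3" where
  "mat_unit i j = (\<chi> k l. if k = i \<and> l = j then 1 else 0)"

lift_definition e_sl3 :: "3 \<Rightarrow> 3 \<Rightarrow> sl3" is
  "\<lambda>i j. mat_unit i j - mat ((if i = j then 1 else 0) / 3)"
proof -
  fix i j :: 3
  show "trace (mat_unit i j - mat ((if i = j then 1 else 0) / 3)) = 0"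
    using exhaust_3[of i] exhaust_3[of j]
    by (auto simp: trace_def mat_unit_def mat_def sum_3)
qed


section \<open>The universal enveloping algebra\<close>

text \<open>Words in elements of \<open>sl3\<close>, under concatenation. The monoid algebra
  \<open>sl3_word \<Rightarrow>\<^sub>0 complex\<close> is the free unital algebra on the set \<open>sl3\<close>; the enveloping algebra is
  its quotient by the ideal that makes the generators linear and turns brackets into
  commutators.\<close>

datatype sl3_word = Word (letters: "sl3 list")

instantiation sl3_word :: monoid_add
begin
definition "0 = Word []"
definition "v + w = Word (letters v @ letters w)"
instance by standard (auto simp: zero_sl3_word_def plus_sl3_word_def)
end

type_synonym free_sl3 = "sl3_word \<Rightarrow>\<^sub>0 complex"

abbreviation free_gen :: "sl3 \<Rightarrow> free_sl3" where
  "free_gen X \<equiv> Poly_Mapping.single (Word [X]) 1"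

abbreviation free_const :: "complex \<Rightarrow> free_sl3" where
  "free_const c \<equiv> Poly_Mapping.single 0 c"

lemma free_sl3_induct [case_names zero single add]:
  fixes p :: free_sl3
  assumes "P 0" "\<And>w c. P (Poly_Mapping.single w c)" "\<And>p q. P p \<Longrightarrow> P q \<Longrightarrow> P (p + q)"
  shows "P p"
proof (induction p rule: update_induct)
  case const
  then show ?case using assms(1) by simp
next
  case (update f a b)
  have "Poly_Mapping.update a b f = f + Poly_Mapping.single a b"
    using update(1)
    by (intro poly_mapping_eqI)
       (auto simp: lookup_update lookup_add lookup_single when_def in_keys_iff)
  then show ?case using update assms(2,3) by simp
qed

lemma single_sl3_word_mult:
  "Poly_Mapping.single (Word xs) c * Poly_Mapping.single (Word ys) d
     = (Poly_Mapping.single (Word (xs @ ys)) (c * d) :: free_sl3)"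
  by (simp add: mult_single plus_sl3_word_def)

inductive_set usl3_rel :: "free_sl3 set" where
  "free_gen (X + Y) - free_gen X - free_gen Y \<in> usl3_rel"
| "free_gen (sl3_scale c X) - free_const c * free_gen X \<in> usl3_rel"
| "free_gen X * free_gen Y - free_gen Y * free_gen X - free_gen (sl3_bracket X Y) \<in> usl3_rel"

inductive_set usl3_ideal :: "free_sl3 set" where
  zero: "0 \<in> usl3_ideal"
| gen: "r \<in> usl3_rel \<Longrightarrow> a * r * b \<in> usl3_ideal"
| add: "p \<in> usl3_ideal \<Longrightarrow> q \<in> usl3_ideal \<Longrightarrow> p + q \<in> usl3_ideal"

lemma usl3_ideal_mult_left: "p \<in> usl3_ideal \<Longrightarrow> c * p \<in> usl3_ideal"
proof (induction rule: usl3_ideal.induct)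
  case (gen r a b)
  then show ?case using usl3_ideal.gen[of r "c * a" b] by (simp add: mult.assoc)
qed (auto simp: distrib_left intro: usl3_ideal.intros)

lemma usl3_ideal_mult_right: "p \<in> usl3_ideal \<Longrightarrow> p * c \<in> usl3_ideal"
proof (induction rule: usl3_ideal.induct)
  case (gen r a b)
  then show ?case using usl3_ideal.gen[of r a "b * c"] by (simp add: mult.assoc)
qed (auto simp: distrib_right intro: usl3_ideal.intros)

lemma usl3_ideal_uminus: "p \<in> usl3_ideal \<Longrightarrow> - p \<in> usl3_ideal"
  using usl3_ideal_mult_left[of p "-1"] by simp

definition usl3_eq :: "free_sl3 \<Rightarrow> free_sl3 \<Rightarrow> bool" where
  "usl3_eq p q \<longleftrightarrow> p - q \<in> usl3_ideal"

quotient_type usl3 = free_sl3 / usl3_eq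
proof (rule equivpI)
  show "reflp usl3_eq" by (auto simp: reflp_def usl3_eq_def usl3_ideal.zero)
  show "symp usl3_eq"
    unfolding symp_def usl3_eq_def by (auto dest: usl3_ideal_uminus)
  show "transp usl3_eq"
    unfolding transp_def usl3_eq_def
  proof (intro allI impI)
    fix p q r :: free_sl3
    assume "p - q \<in> usl3_ideal" "q - r \<in> usl3_ideal"
    then have "(p - q) + (q - r) \<in> usl3_ideal" by (rule usl3_ideal.add)
    then show "p - r \<in> usl3_ideal" by simp
  qed
qed

lemma one_notin_usl3_ideal: "1 \<notin> usl3_ideal"
proof -
  have mult: "Poly_Mapping.lookup (p * q) 0 = Poly_Mapping.lookup p 0 * Poly_Mapping.lookup q 0" for p q :: free_sl3
  proof (induction p rule: free_sl3_induct)
    case (single w c)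
    show ?case
    proof (induction q rule: free_sl3_induct)
      case (single v d)
      show ?case
        by (cases w; cases v)
           (auto simp: mult_single lookup_single when_def plus_sl3_word_def zero_sl3_word_def)
    qed (auto simp: lookup_add distrib_left)
  qed (auto simp: lookup_add distrib_right)
  have [simp]: "Poly_Mapping.lookup (free_gen X) 0 = 0" for X
    by (simp add: lookup_single zero_sl3_word_def)
  have rel: "Poly_Mapping.lookup r 0 = 0" if "r \<in> usl3_rel" for r
    using that
    by cases (auto simp: lookup_minus mult)
  have "Poly_Mapping.lookup p 0 = 0" if "p \<in> usl3_ideal" for p
    using that by induction (auto simp: mult rel lookup_add)
  from this[of 1] show ?thesis by (auto simp: lookup_one)
qed

instantiation usl3 :: ring_1
begin
lift_definition zero_usl3 :: usl3 is 0 .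
lift_definition one_usl3 :: usl3 is 1 .
lift_definition plus_usl3 :: "usl3 \<Rightarrow> usl3 \<Rightarrow> usl3" is "(+)"
proof -
  fix p p' q q' :: free_sl3
  assume "usl3_eq p p'" "usl3_eq q q'"
  then have "(p - p') + (q - q') \<in> usl3_ideal"
    unfolding usl3_eq_def by (rule usl3_ideal.add)
  then show "usl3_eq (p + q) (p' + q')" by (simp add: usl3_eq_def algebra_simps)
qed
lift_definition uminus_usl3 :: "usl3 \<Rightarrow> usl3" is uminus
proof -
  fix p p' :: free_sl3
  assume "usl3_eq p p'"
  then have "- (p - p') \<in> usl3_ideal"
    unfolding usl3_eq_def by (rule usl3_ideal_uminus)
  then show "usl3_eq (- p) (- p')" by (simp add: usl3_eq_def)
qed
lift_definition minus_usl3 :: "usl3 \<Rightarrow> usl3 \<Rightarrow> usl3" is "(-)"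
proof -
  fix p p' q q' :: free_sl3
  assume "usl3_eq p p'" "usl3_eq q q'"
  then have "(p - p') + - (q - q') \<in> usl3_ideal"
    unfolding usl3_eq_def by (intro usl3_ideal.add usl3_ideal_uminus)
  then show "usl3_eq (p - q) (p' - q')" by (simp add: usl3_eq_def algebra_simps)
qed
lift_definition times_usl3 :: "usl3 \<Rightarrow> usl3 \<Rightarrow> usl3" is "(*)"
proof -
  fix p p' q q' :: free_sl3
  assume "usl3_eq p p'" "usl3_eq q q'"
  then have "(p - p') * q + p' * (q - q') \<in> usl3_ideal"
    unfolding usl3_eq_def
    by (intro usl3_ideal.add usl3_ideal_mult_left usl3_ideal_mult_right)
  then show "usl3_eq (p * q) (p' * q')" by (simp add: usl3_eq_def algebra_simps)
qed
instance
proof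
  show "(0::usl3) \<noteq> 1"
    using one_notin_usl3_ideal by transfer (auto simp: usl3_eq_def dest: usl3_ideal_uminus)
qed (transfer; simp add: algebra_simps usl3_eq_def usl3_ideal.zero)+
end

lift_definition usl3_scale :: "complex \<Rightarrow> usl3 \<Rightarrow> usl3" is "\<lambda>c p. free_const c * p"
  unfolding usl3_eq_def by (simp add: usl3_ideal_mult_left flip: right_diff_distrib)

lift_definition usl3_gen :: "sl3 \<Rightarrow> usl3" is free_gen .

definition U_e :: "3 \<Rightarrow> 3 \<Rightarrow> usl3" where
  "U_e i j = usl3_gen (e_sl3 i j)"

definition U_H :: usl3 where "U_H = U_e 1 1 - U_e 2 2"

definition U_Y :: usl3 where "U_Y = usl3_scale (1/3) (U_e 1 1 + U_e 2 2 - 2 * U_e 3 3)"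

definition U_J :: usl3 where
  "U_J = usl3_scale (1/4) ((U_e 1 1 - U_e 2 2)\<^sup>2 + 2 * (U_e 1 1 - U_e 2 2)) + U_e 2 1 * U_e 1 2"


section \<open>The automorphisms of the enveloping algebra given by rotations\<close>

definition sl3_hom :: "(sl3 \<Rightarrow> sl3) \<Rightarrow> bool" where
  "sl3_hom f \<longleftrightarrow> (\<forall>X Y. f (X + Y) = f X + f Y) \<and> (\<forall>c X. f (sl3_scale c X) = sl3_scale c (f X))
     \<and> (\<forall>X Y. f (sl3_bracket X Y) = sl3_bracket (f X) (f Y))"

definition free_map :: "(sl3 \<Rightarrow> sl3) \<Rightarrow> free_sl3 \<Rightarrow> free_sl3" where
  "free_map f p =
     (\<Sum>w\<in>Poly_Mapping.keys p. Poly_Mapping.single (Word (map f (letters w))) (Poly_Mapping.lookup p w))"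

text \<open>The extension of a Lie algebra endomorphism to the enveloping algebra; for other \<open>f\<close>
  the result depends on the representative chosen by \<^const>\<open>rep_usl3\<close>.\<close>

definition usl3_map :: "(sl3 \<Rightarrow> sl3) \<Rightarrow> usl3 \<Rightarrow> usl3" where
  "usl3_map f u = abs_usl3 (free_map f (rep_usl3 u))"

lemma free_map_zero: "free_map f 0 = 0"
  by (simp add: free_map_def)

lemma free_map_single:
  "free_map f (Poly_Mapping.single w c) = Poly_Mapping.single (Word (map f (letters w))) c"
  by (simp add: free_map_def)

lemma free_map_const: "free_map f (free_const c) = free_const c"
  unfolding zero_sl3_word_def free_map_single by simp

lemma free_map_add: "free_map f (p + q) = free_map f p + free_map f q"
proof -
  let ?A = "Poly_Mapping.keys p \<union> Poly_Mapping.keys q"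
  have *: "free_map f r =
      (\<Sum>w\<in>?A. Poly_Mapping.single (Word (map f (letters w))) (Poly_Mapping.lookup r w))"
    if "Poly_Mapping.keys r \<subseteq> ?A" for r
    unfolding free_map_def using that
    by (intro sum.mono_neutral_left) (auto simp: in_keys_iff)
  show ?thesis
    using keys_add[of p q] by (simp add: * lookup_add single_add sum.distrib)
qed

lemma free_map_diff: "free_map f (p - q) = free_map f p - free_map f q"
  using free_map_add[of f "p - q" q] by simp

lemma free_map_mult: "free_map f (p * q) = free_map f p * free_map f q"
proof (induction p rule: free_sl3_induct)
  case (single w c)
  show ?case
  proof (induction q rule: free_sl3_induct)
    case (single v d)
    show ?case
      by (cases w; cases v) (simp add: free_map_single single_sl3_word_mult)
  qed (auto simp: free_map_add free_map_zero distrib_left)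
qed (auto simp: free_map_add free_map_zero distrib_right)

lemma free_map_ideal:
  assumes f: "sl3_hom f" and p: "p \<in> usl3_ideal"
  shows "free_map f p \<in> usl3_ideal"
proof -
  have "free_map f r \<in> usl3_rel" if "r \<in> usl3_rel" for r
    using that f unfolding sl3_hom_def
    by cases (auto simp: free_map_diff free_map_mult free_map_const
        free_map_single[of _ "Word xs" for xs] intro: usl3_rel.intros)
  with p show ?thesis
    by induction (auto simp: free_map_zero free_map_add free_map_mult intro: usl3_ideal.intros)
qed

lemma usl3_map_abs:
  assumes "sl3_hom f"
  shows "usl3_map f (abs_usl3 p) = abs_usl3 (free_map f p)"
proof -
  have "usl3_eq (rep_usl3 (abs_usl3 p)) p"
    by (simp add: Quotient_abs_rep[OF Quotient_usl3] flip: usl3.abs_eq_iff)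
  then show ?thesis
    unfolding usl3_map_def usl3.abs_eq_iff
    using free_map_ideal[OF assms] by (simp add: usl3_eq_def flip: free_map_diff)
qed

lemma usl3_map_gen: "sl3_hom f \<Longrightarrow> usl3_map f (usl3_gen X) = usl3_gen (f X)"
  by (simp add: usl3_gen.abs_eq usl3_map_abs free_map_single)

lemma usl3_map_add: "sl3_hom f \<Longrightarrow> usl3_map f (u + v) = usl3_map f u + usl3_map f v"
  by (induct u rule: usl3.abs_induct; induct v rule: usl3.abs_induct)
     (simp add: plus_usl3.abs_eq usl3_map_abs free_map_add)

lemma usl3_map_mult: "sl3_hom f \<Longrightarrow> usl3_map f (u * v) = usl3_map f u * usl3_map f v"
  by (induct u rule: usl3.abs_induct; induct v rule: usl3.abs_induct)
     (simp add: times_usl3.abs_eq usl3_map_abs free_map_mult)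

lemma usl3_map_scale:
  "sl3_hom f \<Longrightarrow> usl3_map f (usl3_scale c u) = usl3_scale c (usl3_map f u)"
  by (induct u rule: usl3.abs_induct)
     (simp add: usl3_scale.abs_eq usl3_map_abs free_map_mult free_map_const)

definition cmat :: "real^3^3 \<Rightarrow> complex^3^3" where
  "cmat R = (\<chi> i j. complex_of_real (R $ i $ j))"

definition conj_sl3 :: "real^3^3 \<Rightarrow> sl3 \<Rightarrow> sl3" where
  "conj_sl3 R X = sl3_of_mat (cmat R ** mat_of_sl3 X ** cmat (matrix_inv R))"

definition Psi :: "real^3^3 \<Rightarrow> usl3 \<Rightarrow> usl3" where
  "Psi R = usl3_map (conj_sl3 R)"


lemma cmat_mult: "cmat (A ** B) = cmat A ** cmat B"
  by (simp add: cmat_def matrix_matrix_mult_def vec_eq_iff)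

lemma cmat_1: "cmat (mat 1) = mat 1"
  by (simp add: cmat_def mat_def vec_eq_iff)

lemma rotation_matrix_inv: "rotation_matrix R \<Longrightarrow> matrix_inv R = transpose R"
proof -
  assume "rotation_matrix R"
  then have R: "R ** transpose R = mat 1" "transpose R ** R = mat 1"
    by (auto simp: rotation_matrix_def orthogonal_matrix_def)
  then have "R ** matrix_inv R = mat 1"
    unfolding matrix_inv_def by (metis (mono_tags, lifting) someI)
  then show ?thesis
    by (metis R(2) matrix_mul_assoc matrix_mul_lid matrix_mul_rid)
qed

lemma mat_of_conj_sl3:
  assumes "rotation_matrix R"
  shows "mat_of_sl3 (conj_sl3 R X) = cmat R ** mat_of_sl3 X ** cmat (matrix_inv R)"
proof -
  have "cmat (matrix_inv R) ** cmat R = mat 1"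
    using assms by (simp add: rotation_matrix_inv rotation_matrix_def orthogonal_matrix_def
        flip: cmat_mult cmat_1)
  then have "trace (cmat R ** mat_of_sl3 X ** cmat (matrix_inv R)) = trace (mat_of_sl3 X)"
    by (metis trace_mul_sym matrix_mul_assoc matrix_mul_lid)
  then show ?thesis
    unfolding conj_sl3_def using mat_of_sl3[of X] by (simp add: sl3_of_mat_inverse)
qed

lemma conj_sl3_hom:
  assumes R: "rotation_matrix R"
  shows "sl3_hom (conj_sl3 R)"
proof -
  let ?A = "cmat R" and ?B = "cmat (matrix_inv R)"
  have "?B ** ?A = mat 1"
    using assms by (simp add: rotation_matrix_inv rotation_matrix_def orthogonal_matrix_def
        flip: cmat_mult cmat_1)
  then have BA: "M ** ?B ** (?A ** N) = M ** N" for M N :: "complex^3^3"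
    by (metis matrix_mul_assoc matrix_mul_lid)
  have prod: "?A ** (M ** N) ** ?B = (?A ** M ** ?B) ** (?A ** N ** ?B)" for M N
    by (metis BA matrix_mul_assoc)
  have add: "conj_sl3 R (X + Y) = conj_sl3 R X + conj_sl3 R Y" for X Y
    unfolding mat_of_sl3_inject[symmetric] mat_of_conj_sl3[OF R] plus_sl3.rep_eq
    by (simp add: matrix_matrix_mult_def vec_eq_iff sum_3 algebra_simps)
  have scale: "conj_sl3 R (sl3_scale c X) = sl3_scale c (conj_sl3 R X)" for c X
    unfolding mat_of_sl3_inject[symmetric] mat_of_conj_sl3[OF R] sl3_scale.rep_eq
    by (simp add: matrix_matrix_mult_def vec_eq_iff sum_3 algebra_simps)
  have "?A ** (M - N) ** ?B = ?A ** M ** ?B - ?A ** N ** ?B" for M N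
    by (simp add: matrix_matrix_mult_def vec_eq_iff sum_3 algebra_simps)
  then have bracket: "conj_sl3 R (sl3_bracket X Y) = sl3_bracket (conj_sl3 R X) (conj_sl3 R Y)" for X Y
    unfolding mat_of_sl3_inject[symmetric] mat_of_conj_sl3[OF R] sl3_bracket.rep_eq
    by (simp add: prod)
  show ?thesis
    unfolding sl3_hom_def using add scale bracket by blast
qed

lemma usl3_gen_add: "usl3_gen (X + Y) = usl3_gen X + usl3_gen Y"
  unfolding usl3_gen.abs_eq plus_usl3.abs_eq usl3.abs_eq_iff usl3_eq_def
  using usl3_ideal.gen[OF usl3_rel.intros(1), of 1 X Y 1] by (simp add: diff_diff_eq)

lemma usl3_gen_scale: "usl3_gen (sl3_scale c X) = usl3_scale c (usl3_gen X)"
  unfolding usl3_gen.abs_eq usl3_scale.abs_eq usl3.abs_eq_iff usl3_eq_def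
  using usl3_ideal.gen[OF usl3_rel.intros(2), of 1 c X 1] by simp

lemma usl3_gen_sum: "usl3_gen (sum f A) = (\<Sum>x\<in>A. usl3_gen (f x))"
proof -
  have "usl3_gen 0 = 0" using usl3_gen_add[of 0 0] by simp
  then show ?thesis
    by (induction A rule: infinite_finite_induct) (auto simp: usl3_gen_add)
qed

lemma Psi_e:
  assumes R: "rotation_matrix R"
  shows "Psi R (U_e i j) =
    (\<Sum>k\<in>UNIV. \<Sum>l\<in>UNIV. usl3_scale (complex_of_real (R $ k $ i * R $ l $ j)) (U_e k l))"
proof -
  have ort: "R ** transpose R = mat 1"  "transpose R ** R = mat 1"
    using R by (auto simp: rotation_matrix_def orthogonal_matrix_def)
  have o: "(\<Sum>k\<in>UNIV. complex_of_real (R $ m $ k) * complex_of_real (R $ n $ k)) = (if m = n then 1 else 0)"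
    "(\<Sum>k\<in>UNIV. complex_of_real (R $ k $ m) * complex_of_real (R $ k $ n)) = (if m = n then 1 else 0)" for m n
    using ort[THEN arg_cong[where f = "\<lambda>M. complex_of_real (M $ m $ n)"]]
    by (auto simp: matrix_matrix_mult_def transpose_def mat_def)
  have L: "(A ** (mat_unit i j - mat c) ** B) $ m $ n =
      A $ m $ i * B $ j $ n - c * (\<Sum>k\<in>UNIV. A $ m $ k * B $ k $ n)"
    for A B :: "complex^3^3" and c m n
    using exhaust_3[of i] exhaust_3[of j]
    by (elim disjE) (simp_all add: matrix_matrix_mult_def mat_unit_def mat_def sum_3 algebra_simps)
  have Rt: "(\<Sum>k\<in>UNIV. \<Sum>l\<in>UNIV. \<chi> i' j'. complex_of_real (R $ k $ i * R $ l $ j) *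
      (mat_unit k l - mat ((if k = l then 1 else 0) / 3)) $ i' $ j') $ m $ n =
    complex_of_real (R $ m $ i) * complex_of_real (R $ n $ j) - (if m = n then 1 else 0) / 3 *
      (\<Sum>k\<in>UNIV. complex_of_real (R $ k $ i) * complex_of_real (R $ k $ j))" for m n
    using exhaust_3[of m] exhaust_3[of n]
    by (elim disjE) (simp_all add: mat_unit_def mat_def sum_3 algebra_simps)
  have ms: "mat_of_sl3 (sum f A) = (\<Sum>x\<in>A. mat_of_sl3 (f x))" for f and A :: "3 set"
    by (induction A rule: infinite_finite_induct) (auto simp: plus_sl3.rep_eq zero_sl3.rep_eq)
  have "conj_sl3 R (e_sl3 i j) = (\<Sum>k\<in>UNIV. \<Sum>l\<in>UNIV.
     sl3_scale (complex_of_real (R $ k $ i * R $ l $ j)) (e_sl3 k l))"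
    unfolding mat_of_sl3_inject[symmetric] mat_of_conj_sl3[OF R] ms rotation_matrix_inv[OF R]
      sl3_scale.rep_eq e_sl3.rep_eq vec_eq_iff
  proof (intro allI)
    fix m n :: 3
    show "(cmat R ** (mat_unit i j - mat ((if i = j then 1 else 0) / 3)) ** cmat (transpose R)) $ m $ n
      = (\<Sum>k\<in>UNIV. \<Sum>l\<in>UNIV. \<chi> i' j'. complex_of_real (R $ k $ i * R $ l $ j) *
          (mat_unit k l - mat ((if k = l then 1 else 0) / 3)) $ i' $ j') $ m $ n"
      unfolding L Rt by (simp add: o cmat_def transpose_def)
  qed
  then show ?thesis
    unfolding Psi_def U_e_def
    by (simp add: usl3_map_gen conj_sl3_hom R usl3_gen_sum usl3_gen_scale)
qed

section \<open>The Gelfand--Tsetlin module\<close>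

text \<open>Highest weights are triples \<open>(l31, l32, l33)\<close>, patterns are triples \<open>(l11, l21, l22)\<close>.\<close>

type_synonym weight = "complex \<times> complex \<times> complex"
type_synonym gt_pattern = "complex \<times> complex \<times> complex"
type_synonym gt_vec = "gt_pattern \<Rightarrow> complex"

definition highest_weight :: "weight \<Rightarrow> bool" where
  "highest_weight = (\<lambda>(l31, l32, l33). l31 - l32 \<in> \<nat> \<and> l32 - l33 \<in> \<nat> \<and> l31 + l32 + l33 = 0)"

definition GT_patterns :: "weight \<Rightarrow> gt_pattern set" where
  "GT_patterns = (\<lambda>(l31, l32, l33). {(l11, l21, l22).
     l31 - l21 \<in> \<nat> \<and> l21 - l32 \<in> \<nat> \<and> l32 - l22 \<in> \<nat> \<and> l22 - l33 \<in> \<nat> \<and>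
     l21 - l11 \<in> \<nat> \<and> l11 - l22 \<in> \<nat>})"

definition d11 :: gt_pattern where "d11 = (1, 0, 0)"
definition d21 :: gt_pattern where "d21 = (0, 1, 0)"
definition d22 :: gt_pattern where "d22 = (0, 0, 1)"

text \<open>The module consists of the coordinate vectors supported on the (finite) set of patterns.\<close>

definition V_space :: "weight \<Rightarrow> gt_vec set" where
  "V_space lam = {v. \<forall>M. M \<notin> GT_patterns lam \<longrightarrow> v M = 0}"

definition vscale :: "complex \<Rightarrow> gt_vec \<Rightarrow> gt_vec" (infixr "\<cdot>" 75) where
  "c \<cdot> v = (\<lambda>M. c * v M)"

definition xi :: "weight \<Rightarrow> gt_pattern \<Rightarrow> gt_vec" where
  "xi lam L = (\<lambda>M. if L \<in> GT_patterns lam \<and> M = L then 1 else 0)"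

definition lin_ext :: "weight \<Rightarrow> (gt_pattern \<Rightarrow> gt_vec) \<Rightarrow> gt_vec \<Rightarrow> gt_vec" where
  "lin_ext lam f v = (\<Sum>L\<in>GT_patterns lam. v L \<cdot> f L)"

definition gt11 :: "weight \<Rightarrow> gt_vec \<Rightarrow> gt_vec" where
  "gt11 lam = lin_ext lam (\<lambda>L. case L of (l11, l21, l22) \<Rightarrow> l11 \<cdot> xi lam L)"

definition gt22 :: "weight \<Rightarrow> gt_vec \<Rightarrow> gt_vec" where
  "gt22 lam = lin_ext lam (\<lambda>L. case L of (l11, l21, l22) \<Rightarrow> (l21 + l22 - l11) \<cdot> xi lam L)"

definition gt33 :: "weight \<Rightarrow> gt_vec \<Rightarrow> gt_vec" where
  "gt33 lam = lin_ext lam (\<lambda>L. case L of (l11, l21, l22) \<Rightarrow> (- (l21 + l22)) \<cdot> xi lam L)"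

definition gt12 :: "weight \<Rightarrow> gt_vec \<Rightarrow> gt_vec" where
  "gt12 lam = lin_ext lam (\<lambda>L. case L of (l11, l21, l22) \<Rightarrow>
     ((l21 - l11) * (l11 - l22 + 1)) \<cdot> xi lam (L + d11))"

definition gt21 :: "weight \<Rightarrow> gt_vec \<Rightarrow> gt_vec" where
  "gt21 lam = lin_ext lam (\<lambda>L. xi lam (L - d11))"

definition gt23 :: "weight \<Rightarrow> gt_vec \<Rightarrow> gt_vec" where
  "gt23 lam = (case lam of (l31, l32, l33) \<Rightarrow>
     lin_ext lam (\<lambda>L. case L of (l11, l21, l22) \<Rightarrow>
       ((l31 - l21) / (l21 - l22 + 1)) \<cdot> xi lam (L + d21)
     + ((l31 - l22 + 1) / (l21 - l22 + 1)) \<cdot> xi lam (L + d22)))"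

definition gt32 :: "weight \<Rightarrow> gt_vec \<Rightarrow> gt_vec" where
  "gt32 lam = (case lam of (l31, l32, l33) \<Rightarrow>
     lin_ext lam (\<lambda>L. case L of (l11, l21, l22) \<Rightarrow>
       ((l21 - l32) * (l21 - l33 + 1) * (l21 - l11) / (l21 - l22 + 1)) \<cdot> xi lam (L - d21)
     + ((l11 - l22 + 1) * (l32 - l22 + 1) * (l22 - l33) / (l21 - l22 + 1)) \<cdot> xi lam (L - d22)))"

definition commutator :: "(gt_vec \<Rightarrow> gt_vec) \<Rightarrow> (gt_vec \<Rightarrow> gt_vec) \<Rightarrow> gt_vec \<Rightarrow> gt_vec" where
  "commutator A B v = A (B v) - B (A v)"

definition gt_e :: "weight \<Rightarrow> 3 \<Rightarrow> 3 \<Rightarrow> gt_vec \<Rightarrow> gt_vec" where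
  "gt_e lam i j =
    (if i = 1 then
       (if j = 1 then gt11 lam else if j = 2 then gt12 lam
        else commutator (gt12 lam) (gt23 lam))
     else if i = 2 then
       (if j = 1 then gt21 lam else if j = 2 then gt22 lam else gt23 lam)
     else
       (if j = 1 then commutator (gt32 lam) (gt21 lam) else if j = 2 then gt32 lam
        else gt33 lam))"

text \<open>A traceless matrix \<open>X\<close> equals \<open>\<Sum>i j. X $ i $ j *\<close> \<^term>\<open>e_sl3 i j\<close>.\<close>

definition rho :: "weight \<Rightarrow> sl3 \<Rightarrow> gt_vec \<Rightarrow> gt_vec" where
  "rho lam X v = (\<Sum>i\<in>UNIV. \<Sum>j\<in>UNIV. (mat_of_sl3 X $ i $ j) \<cdot> gt_e lam i j v)"

text \<open>The action of the enveloping algebra through a map \<open>r\<close> on generators. It does not depend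
  on the representative when \<open>r\<close> is a representation of the Lie algebra.\<close>

definition free_act :: "(sl3 \<Rightarrow> gt_vec \<Rightarrow> gt_vec) \<Rightarrow> free_sl3 \<Rightarrow> gt_vec \<Rightarrow> gt_vec" where
  "free_act r p v = (\<Sum>w\<in>Poly_Mapping.keys p. Poly_Mapping.lookup p w \<cdot> foldr r (letters w) v)"

text \<open>Independence of the representative, and the module axioms, for any \<open>r\<close> that is a
  representation of the Lie algebra.\<close>

definition vlinear :: "(gt_vec \<Rightarrow> gt_vec) \<Rightarrow> bool" where
  "vlinear f \<longleftrightarrow> (\<forall>u v. f (u + v) = f u + f v) \<and> (\<forall>c v. f (c \<cdot> v) = c \<cdot> f v)"

definition sl3_rep :: "(sl3 \<Rightarrow> gt_vec \<Rightarrow> gt_vec) \<Rightarrow> bool" where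
  "sl3_rep r \<longleftrightarrow> (\<forall>X. vlinear (r X)) \<and> (\<forall>X Y v. r (X + Y) v = r X v + r Y v) \<and>
     (\<forall>c X v. r (sl3_scale c X) v = c \<cdot> r X v) \<and>
     (\<forall>X Y. r (sl3_bracket X Y) = commutator (r X) (r Y))"

lemma vscale_simps:
  "(c + d) \<cdot> v = c \<cdot> v + d \<cdot> v" "c \<cdot> (u + v) = c \<cdot> u + c \<cdot> v" "0 \<cdot> v = 0" "c \<cdot> 0 = 0"
  "1 \<cdot> v = v" "c \<cdot> (d \<cdot> v) = (c * d) \<cdot> v"
  by (auto simp: vscale_def fun_eq_iff algebra_simps)

lemma free_act_zero: "free_act r 0 v = 0"
  by (simp add: free_act_def)

lemma free_act_single: "free_act r (Poly_Mapping.single w c) v = c \<cdot> foldr r (letters w) v"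
  by (simp add: free_act_def vscale_simps)

lemma free_act_const: "free_act r (free_const c) v = c \<cdot> v"
  unfolding zero_sl3_word_def free_act_single by simp

lemma free_act_add: "free_act r (p + q) v = free_act r p v + free_act r q v"
proof -
  let ?A = "Poly_Mapping.keys p \<union> Poly_Mapping.keys q"
  have *: "free_act r x v = (\<Sum>w\<in>?A. Poly_Mapping.lookup x w \<cdot> foldr r (letters w) v)"
    if "Poly_Mapping.keys x \<subseteq> ?A" for x
    unfolding free_act_def using that
    by (intro sum.mono_neutral_left) (auto simp: in_keys_iff vscale_simps)
  show ?thesis
    using keys_add[of p q] by (simp add: * lookup_add vscale_simps sum.distrib)
qed

lemma free_act_diff: "free_act r (p - q) v = free_act r p v - free_act r q v"
  using free_act_add[of r "p - q" q v] by simp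

lemma vlinear_foldr:
  assumes "\<forall>X. vlinear (r X)"
  shows "vlinear (foldr r xs)"
  using assms by (induction xs) (auto simp: vlinear_def)

lemma vlinear_free_act:
  assumes "\<forall>X. vlinear (r X)"
  shows "vlinear (free_act r p)"
proof (induction p rule: free_sl3_induct)
  case (single w c)
  then show ?case
    using vlinear_foldr[OF assms, of "letters w"]
    by (auto simp: vlinear_def free_act_single vscale_simps mult.commute)
qed (auto simp: vlinear_def free_act_zero free_act_add vscale_def algebra_simps)

lemma free_act_mult:
  assumes r: "\<forall>X. vlinear (r X)"
  shows "free_act r (p * q) v = free_act r p (free_act r q v)"
proof (induction q rule: free_sl3_induct)
  case zero
  then show ?case
    using vlinear_free_act[OF r] unfolding vlinear_def
    by (metis free_act_zero mult_zero_right vscale_simps(3))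
next
  case (single w c)
  then show ?case
  proof (induction p rule: free_sl3_induct)
    case (single w' d)
    then show ?case
      using vlinear_foldr[OF r, of "letters w'"]
      by (auto simp: free_act_single mult_single plus_sl3_word_def vlinear_def vscale_simps)
  qed (auto simp: free_act_zero free_act_add distrib_right)
next
  case (add p' q')
  then show ?case
    using vlinear_free_act[OF r] unfolding vlinear_def by (metis distrib_left free_act_add)
qed

lemma free_act_ideal:
  assumes r: "sl3_rep r" and p: "p \<in> usl3_ideal"
  shows "free_act r p v = 0"
proof -
  have lin: "\<forall>X. vlinear (r X)" using r by (simp add: sl3_rep_def)
  have *: "free_act r x w = 0" if "x \<in> usl3_rel" for x w
    using that r unfolding sl3_rep_def
    by cases (auto simp: free_act_diff free_act_mult[OF lin] free_act_const commutator_def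
        free_act_single[of _ "Word xs" for xs] vscale_simps)
  have "free_act r x 0 = 0" for x
    using vlinear_free_act[OF lin] unfolding vlinear_def by (metis vscale_simps(3))
  with p show ?thesis
    by (induction arbitrary: v) (auto simp: free_act_zero free_act_add free_act_mult[OF lin] *)
qed

lemma free_act_cong:
  assumes "sl3_rep r" "abs_usl3 p = abs_usl3 q"
  shows "free_act r p = free_act r q"
  using free_act_ideal[OF assms(1), of "p - q"] assms(2)
  by (auto simp: usl3.abs_eq_iff usl3_eq_def free_act_diff fun_eq_iff)

definition act :: "weight \<Rightarrow> usl3 \<Rightarrow> gt_vec \<Rightarrow> gt_vec" where
  "act lam u = free_act (rho lam) (rep_usl3 u)"


section \<open>Integration to the group\<close>

text \<open>A homomorphism from \<open>SL\<^sub>3\<close> to the invertible operators on the module whose differential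
  at the identity is the Lie algebra action. Only the values of \<open>p\<close> on matrices of determinant 1
  and on vectors of the module matter. Smoothness (even holomorphy) of the homomorphism is a
  consequence of the last clause.\<close>

definition integrates :: "weight \<Rightarrow> (complex^3^3 \<Rightarrow> gt_vec \<Rightarrow> gt_vec) \<Rightarrow> bool" where
  "integrates lam p \<longleftrightarrow>
     (\<forall>g. det g = 1 \<longrightarrow>
        (\<forall>v\<in>V_space lam. p g v \<in> V_space lam) \<and>
        (\<forall>u\<in>V_space lam. \<forall>v\<in>V_space lam. p g (u + v) = p g u + p g v) \<and>
        (\<forall>c. \<forall>v\<in>V_space lam. p g (c \<cdot> v) = c \<cdot> p g v)) \<and>
     (\<forall>v\<in>V_space lam. p (mat 1) v = v) \<and>
     (\<forall>g h. det g = 1 \<and> det h = 1 \<longrightarrow> (\<forall>v\<in>V_space lam. p (g ** h) v = p g (p h v))) \<and>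
     (\<forall>X (c :: real \<Rightarrow> complex^3^3).
        (\<forall>t. det (c t) = 1) \<and> c 0 = mat 1 \<and>
        (c has_vector_derivative mat_of_sl3 X) (at 0) \<longrightarrow>
        (\<forall>v\<in>V_space lam. \<forall>M. ((\<lambda>t. p (c t) v M) has_vector_derivative rho lam X v M) (at 0)))"

end

(* The operators rho need not be checked against the commutation relations pattern by pattern:
   sl3 is spanned by matrices N of square zero, and 1 + t N is then a polynomial curve in SL_3.
   Differentiating p (g (1 + t N) g^-1) (p g v) = p g (p (1 + t N) v) at t = 0 gives
   p g o rho X = rho (g X g^-1) o p g, and differentiating this once more along g = 1 + t N shows
   that rho is a representation. With g = S^-1, the intertwining relation extends along words to
   the enveloping algebra. The explicit relations are its matrix elements for g = H; at the
   boundary of the set of patterns, a coefficient vanishes whenever an intermediate pattern of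
   [e12, e23] or [e32, e21] is missing but the final one is present. *)

theory Submission
  imports Defs
begin

section \<open>Coordinate vectors\<close>

text \<open>The proof is shaped by how little is given at the start. \<open>act\<close> uses a
  chosen representative in the free algebra, and the choice matters until \<open>rho lam\<close> is
  known to respect brackets. Nothing in the definition of \<open>rho\<close> gives this, so it is
  drawn from the existence of \<open>p\<close>. In turn \<open>integrates\<close> speaks only of
  derivatives at 0, coordinate by coordinate, along curves of determinant 1 through the identity,
  and only for vectors in \<open>V_space lam\<close>. Since the module is finite-dimensional, a
  linear operator is pulled out of a derivative by expanding its argument in the basis
  \<open>xi\<close>; no topology on operators enters. The type of vectors contains all functions on
  triples, and \<open>sl3_rep\<close> quantifies over all of them; this gap closes because each
  \<open>rho lam X\<close> sees a vector only through its projection to the module.\<close>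

lemma gt_sum_apply: "(sum f A :: gt_vec) M = (\<Sum>a\<in>A. f a M)"
  by (induction A rule: infinite_finite_induct) auto

lemma vscale_apply [simp]: "(c \<cdot> v) M = c * v M"
  by (simp add: vscale_def)

lemma vscale_diff: "c \<cdot> (u - v) = c \<cdot> u - c \<cdot> v"
  by (simp add: fun_eq_iff algebra_simps)

lemma vscale_sum: "c \<cdot> sum f A = (\<Sum>a\<in>A. c \<cdot> f a)"
  by (auto simp: fun_eq_iff gt_sum_apply sum_distrib_left)

lemma Nats_minus_1:
  assumes "x \<in> \<nat>" "x \<noteq> (0::complex)"
  shows "x - 1 \<in> \<nat>"
proof -
  obtain n where n: "x = of_nat n" using assms by (auto elim: Nats_cases)
  then obtain m where "n = Suc m" using assms by (cases n) auto
  then show ?thesis using n by simp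
qed

text \<open>A single pattern forces l31 - l32 and l32 - l33 to be naturals m and n; any pattern is
  then fixed by three naturals, each at most m + n. Finiteness matters because
  \<open>lin_ext\<close> and all matrix elements are sums over the patterns, and sums over infinite
  sets are 0 by default.\<close>

lemma finite_GT_patterns: "finite (GT_patterns lam)"
proof -
  obtain l31 l32 l33 where lam: "lam = (l31, l32, l33)" by (cases lam)
  show ?thesis
  proof (cases "GT_patterns lam = {}")
    case False
    then obtain a b c where "(a, b, c) \<in> GT_patterns lam" by auto
    then have nats: "l31 - b \<in> \<nat>" "b - l32 \<in> \<nat>" "l32 - c \<in> \<nat>" "c - l33 \<in> \<nat>"
      by (auto simp: lam GT_patterns_def)
    have "(l31 - b) + (b - l32) \<in> \<nat>" "(l32 - c) + (c - l33) \<in> \<nat>"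
      by (rule Nats_add, rule nats, rule nats)+
    then obtain m n where mn: "l31 - l32 = of_nat m" "l32 - l33 = of_nat n"
      by (auto elim!: Nats_cases)
    \<comment> \<open>The three parameters are the gaps l21 - l11, l31 - l21 and l22 - l33.\<close>
    let ?f = "\<lambda>(i, j, k). (l31 - of_nat j - of_nat i, l31 - of_nat j, l33 + of_nat k) :: gt_pattern"
    have "GT_patterns lam \<subseteq> ?f ` ({..m+n} \<times> {..m+n} \<times> {..m+n})"
    proof
      fix L assume L: "L \<in> GT_patterns lam"
      obtain l11 l21 l22 where L_eq: "L = (l11, l21, l22)" by (cases L)
      from L obtain i1 i2 i3 i4 i5 i6 :: nat where
        i: "l31 - l21 = of_nat i1" "l21 - l32 = of_nat i2" "l32 - l22 = of_nat i3"
          "l22 - l33 = of_nat i4" "l21 - l11 = of_nat i5" "l11 - l22 = of_nat i6"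
        unfolding lam GT_patterns_def L_eq by (auto elim!: Nats_cases)
      have "(of_nat (i1 + i2) :: complex) = of_nat m" "(of_nat (i3 + i4) :: complex) = of_nat n"
        "(of_nat (i5 + i6) :: complex) = of_nat (i2 + i3)"
        by (simp_all add: mn[symmetric] i[symmetric])
      then have "i1 + i2 = m" "i3 + i4 = n" "i5 + i6 = i2 + i3" by (simp_all only: of_nat_eq_iff)
      then have "(i5, i1, i4) \<in> {..m+n} \<times> {..m+n} \<times> {..m+n}" by auto
      moreover have "L = ?f (i5, i1, i4)" by (simp add: L_eq i[symmetric])
      ultimately show "L \<in> ?f ` ({..m+n} \<times> {..m+n} \<times> {..m+n})" by blast
    qed
    then show ?thesis by (rule finite_subset) auto
  qed simp
qed

lemma V_space_xi [simp]: "xi lam L \<in> V_space lam"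
  by (auto simp: V_space_def xi_def)

lemma V_space_0 [simp]: "0 \<in> V_space lam"
  by (auto simp: V_space_def)

lemma V_space_add: "u \<in> V_space lam \<Longrightarrow> v \<in> V_space lam \<Longrightarrow> u + v \<in> V_space lam"
  by (auto simp: V_space_def)

lemma V_space_diff: "u \<in> V_space lam \<Longrightarrow> v \<in> V_space lam \<Longrightarrow> u - v \<in> V_space lam"
  by (auto simp: V_space_def)

lemma V_space_vscale: "v \<in> V_space lam \<Longrightarrow> c \<cdot> v \<in> V_space lam"
  by (auto simp: V_space_def)

lemma V_space_sum: "(\<And>a. a \<in> A \<Longrightarrow> f a \<in> V_space lam) \<Longrightarrow> sum f A \<in> V_space lam"
  by (auto simp: V_space_def gt_sum_apply)

text \<open>The projection of arbitrary coordinate functions onto the module. It carries identities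
  proved on \<open>V_space lam\<close> over to all vectors.\<close>

definition restr :: "weight \<Rightarrow> gt_vec \<Rightarrow> gt_vec" where
  "restr lam v = (\<Sum>L\<in>GT_patterns lam. v L \<cdot> xi lam L)"

lemma restr_apply: "restr lam v M = (if M \<in> GT_patterns lam then v M else 0)"
proof -
  have "restr lam v M = (\<Sum>L\<in>GT_patterns lam. if L = M then v L else 0)"
    unfolding restr_def gt_sum_apply by (intro sum.cong) (auto simp: xi_def)
  then show ?thesis by (simp add: finite_GT_patterns)
qed

lemma restr_in_V [simp]: "restr lam v \<in> V_space lam"
  by (simp add: V_space_def restr_apply)

lemma restr_id: "v \<in> V_space lam \<Longrightarrow> restr lam v = v"
  by (auto simp: V_space_def restr_apply fun_eq_iff)

text \<open>Weaker than \<open>vlinear\<close>, because \<open>integrates\<close> says nothing about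
  the group operators outside the module.\<close>

definition linear_on_V :: "weight \<Rightarrow> (gt_vec \<Rightarrow> gt_vec) \<Rightarrow> bool" where
  "linear_on_V lam T \<longleftrightarrow> (\<forall>v\<in>V_space lam. T v \<in> V_space lam) \<and>
     (\<forall>u\<in>V_space lam. \<forall>v\<in>V_space lam. T (u + v) = T u + T v) \<and>
     (\<forall>c. \<forall>v\<in>V_space lam. T (c \<cdot> v) = c \<cdot> T v)"

lemma linear_on_V_0:
  assumes "linear_on_V lam T"
  shows "T 0 = 0"
proof -
  have "T (0 \<cdot> 0) = 0 \<cdot> T 0" using assms unfolding linear_on_V_def by (metis V_space_0)
  then show ?thesis by (simp add: vscale_simps)
qed

lemma linear_on_V_sum:
  assumes T: "linear_on_V lam T" and f: "\<And>a. a \<in> A \<Longrightarrow> f a \<in> V_space lam"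
  shows "T (\<Sum>a\<in>A. f a) = (\<Sum>a\<in>A. T (f a))"
  using f
proof (induction A rule: infinite_finite_induct)
  case (insert x F)
  have "T (f x + sum f F) = T (f x) + T (sum f F)"
    using T V_space_sum[of F f lam] insert.prems unfolding linear_on_V_def by blast
  moreover have "T (sum f F) = (\<Sum>a\<in>F. T (f a))"
    using insert by blast
  ultimately show ?case
    unfolding sum.insert[OF insert.hyps(1,2)] by metis
qed (use linear_on_V_0[OF T] in auto)

text \<open>The vectors \<open>T (xi lam L)\<close> are fixed, so differentiating T along a curve in
  the module reduces to differentiating finitely many coordinates.\<close>

lemma linear_on_V_expand:
  assumes T: "linear_on_V lam T" and v: "v \<in> V_space lam"
  shows "T v = (\<Sum>L\<in>GT_patterns lam. v L \<cdot> T (xi lam L))"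
proof -
  have "T v = T (restr lam v)" using v by (simp add: restr_id)
  also have "\<dots> = (\<Sum>L\<in>GT_patterns lam. T (v L \<cdot> xi lam L))"
    unfolding restr_def by (intro linear_on_V_sum[OF T] V_space_vscale) simp
  also have "\<dots> = (\<Sum>L\<in>GT_patterns lam. v L \<cdot> T (xi lam L))"
    using T by (simp add: linear_on_V_def)
  finally show ?thesis .
qed

section \<open>The operators of the module\<close>

lemma vlinear_add: "vlinear f \<Longrightarrow> f (u + v) = f u + f v"
  by (simp add: vlinear_def)

lemma vlinear_vscale: "vlinear f \<Longrightarrow> f (c \<cdot> v) = c \<cdot> f v"
  by (simp add: vlinear_def)

lemma vlinear_0: "vlinear f \<Longrightarrow> f 0 = 0"
  by (metis vlinear_vscale vscale_simps(3))

text \<open>Properties that every \<open>lin_ext\<close> into the module has and that survive sums,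
  scalings and commutators, hence reach each \<open>rho lam X\<close>. The last clause says that
  values off the patterns are ignored.\<close>

definition gt_operator :: "weight \<Rightarrow> (gt_vec \<Rightarrow> gt_vec) \<Rightarrow> bool" where
  "gt_operator lam f \<longleftrightarrow> vlinear f \<and> (\<forall>v. f v \<in> V_space lam) \<and> (\<forall>v. f (restr lam v) = f v)"

lemma gt_operator_linear_on_V: "gt_operator lam f \<Longrightarrow> linear_on_V lam f"
  by (simp add: gt_operator_def linear_on_V_def vlinear_def)

lemma gt_operator_lin_ext:
  assumes "\<And>L. f L \<in> V_space lam"
  shows "gt_operator lam (lin_ext lam f)"
  unfolding gt_operator_def
proof (intro conjI allI)
  show "vlinear (lin_ext lam f)"
    by (auto simp: vlinear_def lin_ext_def fun_eq_iff gt_sum_apply sum.distrib sum_distrib_left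
        algebra_simps)
  show "lin_ext lam f v \<in> V_space lam" for v
    unfolding lin_ext_def using assms by (intro V_space_sum V_space_vscale)
  show "lin_ext lam f (restr lam v) = lin_ext lam f v" for v
    unfolding lin_ext_def by (intro sum.cong) (auto simp: restr_apply)
qed

lemma gt_operator_compose:
  "gt_operator lam f \<Longrightarrow> gt_operator lam g \<Longrightarrow> gt_operator lam (\<lambda>v. f (g v))"
  by (auto simp: gt_operator_def vlinear_def)

lemma gt_operator_diff:
  assumes f: "gt_operator lam f" and g: "gt_operator lam g"
  shows "gt_operator lam (\<lambda>v. f v - g v)"
proof -
  have "f (u + v) - g (u + v) = (f u - g u) + (f v - g v)" for u v
    using f g by (simp only: gt_operator_def vlinear_def add_diff_add)
  moreover have "f (c \<cdot> v) - g (c \<cdot> v) = c \<cdot> (f v - g v)" for c v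
    using f g by (simp only: gt_operator_def vlinear_def vscale_diff)
  moreover have "f v - g v \<in> V_space lam" "f (restr lam v) - g (restr lam v) = f v - g v" for v
    using f g by (simp_all only: gt_operator_def V_space_diff)
  ultimately show ?thesis unfolding gt_operator_def vlinear_def by blast
qed

lemma gt_operator_vscale:
  assumes f: "gt_operator lam f"
  shows "gt_operator lam (\<lambda>v. c \<cdot> f v)"
proof -
  have "c \<cdot> f (u + v) = c \<cdot> f u + c \<cdot> f v" for u v
    using f by (simp only: gt_operator_def vlinear_def vscale_simps)
  moreover have "c \<cdot> f (d \<cdot> v) = d \<cdot> c \<cdot> f v" for d v
    using f by (simp only: gt_operator_def vlinear_def vscale_simps mult.commute)
  moreover have "c \<cdot> f v \<in> V_space lam" "c \<cdot> f (restr lam v) = c \<cdot> f v" for v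
    using f by (simp_all only: gt_operator_def V_space_vscale)
  ultimately show ?thesis unfolding gt_operator_def vlinear_def by blast
qed

lemma gt_operator_sum:
  assumes f: "\<And>a. a \<in> A \<Longrightarrow> gt_operator lam (f a)"
  shows "gt_operator lam (\<lambda>v. \<Sum>a\<in>A. f a v)"
proof -
  have "(\<Sum>a\<in>A. f a (u + v)) = (\<Sum>a\<in>A. f a u) + (\<Sum>a\<in>A. f a v)" for u v
    unfolding sum.distrib[symmetric] using f
    by (intro sum.cong refl) (simp only: gt_operator_def vlinear_def)
  moreover have "(\<Sum>a\<in>A. f a (c \<cdot> v)) = c \<cdot> (\<Sum>a\<in>A. f a v)" for c v
    unfolding vscale_sum using f by (intro sum.cong refl) (simp only: gt_operator_def vlinear_def)
  moreover have "(\<Sum>a\<in>A. f a v) \<in> V_space lam" for v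
    using f by (intro V_space_sum) (simp only: gt_operator_def)
  moreover have "(\<Sum>a\<in>A. f a (restr lam v)) = (\<Sum>a\<in>A. f a v)" for v
    using f by (intro sum.cong refl) (simp only: gt_operator_def)
  ultimately show ?thesis unfolding gt_operator_def vlinear_def by blast
qed

lemma gt_operator_commutator:
  assumes "gt_operator lam f" "gt_operator lam g"
  shows "gt_operator lam (commutator f g)"
proof -
  have "commutator f g = (\<lambda>v. f (g v) - g (f v))"
    by (intro ext commutator_def)
  moreover have "gt_operator lam \<dots>"
    by (rule gt_operator_diff; rule gt_operator_compose; fact assms)
  ultimately show ?thesis by simp
qed

lemma gt_operator_gt_e: "gt_operator lam (gt_e lam i j)"
proof -
  obtain l31 l32 l33 where lam: "lam = (l31, l32, l33)" by (cases lam)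
  have "gt_operator lam (gt11 lam)" "gt_operator lam (gt22 lam)" "gt_operator lam (gt33 lam)"
    "gt_operator lam (gt12 lam)" "gt_operator lam (gt21 lam)"
    unfolding gt11_def gt22_def gt33_def gt12_def gt21_def
    by (rule gt_operator_lin_ext, simp add: V_space_vscale split: prod.split)+
  moreover have "gt_operator lam (gt23 lam)" "gt_operator lam (gt32 lam)"
    unfolding gt23_def gt32_def lam prod.case
    by (rule gt_operator_lin_ext, simp only: split: prod.split,
        intro allI impI V_space_add V_space_vscale V_space_xi)+
  ultimately show ?thesis
    by (simp add: gt_e_def gt_operator_commutator)
qed

lemma gt_operator_rho: "gt_operator lam (rho lam X)"
proof -
  have "rho lam X = (\<lambda>v. \<Sum>i\<in>UNIV. \<Sum>j\<in>UNIV. (mat_of_sl3 X $ i $ j) \<cdot> gt_e lam i j v)"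
    by (intro ext rho_def)
  moreover have "gt_operator lam \<dots>"
    by (rule gt_operator_sum, rule gt_operator_sum, rule gt_operator_vscale, rule gt_operator_gt_e)
  ultimately show ?thesis by simp
qed

lemma vlinear_rho: "vlinear (rho lam X)"
  using gt_operator_rho[of lam X] by (simp only: gt_operator_def)

lemma rho_in_V [simp]: "rho lam X v \<in> V_space lam"
  using gt_operator_rho[of lam X] by (simp only: gt_operator_def)

lemma rho_restr: "rho lam X (restr lam v) = rho lam X v"
  using gt_operator_rho[of lam X] by (simp only: gt_operator_def)

lemma rho_add: "rho lam (X + Y) v = rho lam X v + rho lam Y v"
  by (simp only: rho_def plus_sl3.rep_eq vscale_simps sum.distrib vector_add_component)

lemma rho_sl3_scale: "rho lam (sl3_scale c X) v = c \<cdot> rho lam X v"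
  by (simp only: rho_def sl3_scale.rep_eq vscale_simps vscale_sum vec_lambda_beta)

section \<open>Square-zero matrices\<close>

text \<open>The first clause gives the inverse 1 - t N; the second keeps 1 + t N in SL_3 for all
  real t, as the curves in \<open>integrates\<close> must be.\<close>

definition square_zero :: "complex^3^3 \<Rightarrow> bool" where
  "square_zero N \<longleftrightarrow> N ** N = 0 \<and> (\<forall>t::real. det (mat 1 + t *\<^sub>R N) = 1)"

lemma scaleR_matrix_mult_left:
  fixes A :: "complex^'n^'m" and B :: "complex^'k^'n"
  shows "(t *\<^sub>R A) ** B = t *\<^sub>R (A ** B)"
  by (simp add: matrix_matrix_mult_def vec_eq_iff scaleR_sum_right)

lemma scaleR_matrix_mult_right:
  fixes A :: "complex^'n^'m" and B :: "complex^'k^'n"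
  shows "A ** (t *\<^sub>R B) = t *\<^sub>R (A ** B)"
  by (simp add: matrix_matrix_mult_def vec_eq_iff scaleR_sum_right)

lemma matrix_diff_ldistrib:
  fixes A :: "complex^'n^'m" and B C :: "complex^'k^'n"
  shows "A ** (B - C) = A ** B - A ** C"
  by (simp add: matrix_matrix_mult_def vec_eq_iff sum_subtractf algebra_simps)

lemma matrix_add_rdistrib:
  fixes A B :: "complex^'n^'m" and C :: "complex^'k^'n"
  shows "(A + B) ** C = A ** C + B ** C"
  by (simp add: matrix_matrix_mult_def vec_eq_iff sum.distrib algebra_simps)

lemmas matrix_distribs = scaleR_matrix_mult_left scaleR_matrix_mult_right matrix_diff_ldistrib
  matrix_add_rdistrib matrix_add_ldistrib

lemma mat_1_scaleR_conj:
  fixes g h N :: "complex^3^3"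
  assumes "g ** h = mat 1"
  shows "g ** (mat 1 + t *\<^sub>R N) ** h = mat 1 + t *\<^sub>R (g ** N ** h)"
  using assms by (simp add: matrix_distribs)

text \<open>Makes g (1 + t N) h an admissible curve as well: it is 1 + t N' for the conjugate N' of
  N.\<close>

lemma square_zero_conj:
  assumes "square_zero N" "g ** h = mat 1" "h ** g = mat 1"
  shows "square_zero (g ** N ** h)"
proof -
  have "(g ** N ** h) ** (g ** N ** h) = g ** N ** (h ** g) ** N ** h"
    by (simp only: matrix_mul_assoc)
  also have "\<dots> = g ** (N ** N) ** h"
    by (simp add: assms(3) matrix_mul_assoc)
  also have "\<dots> = 0"
    using assms(1) by (simp add: square_zero_def)
  finally have "(g ** N ** h) ** (g ** N ** h) = 0" .
  moreover have "det (mat 1 + t *\<^sub>R (g ** N ** h)) = 1" for t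
  proof -
    have "det (mat 1 + t *\<^sub>R (g ** N ** h)) = det g * det (mat 1 + t *\<^sub>R N) * det h"
      unfolding mat_1_scaleR_conj[OF assms(2), symmetric] det_mul ..
    also have "\<dots> = det (g ** h)"
      using assms(1) by (simp add: square_zero_def det_mul)
    finally show ?thesis using assms(2) by simp
  qed
  ultimately show ?thesis by (simp add: square_zero_def)
qed

lemma square_zero_inverse:
  assumes "square_zero N"
  shows "(mat 1 + t *\<^sub>R N) ** (mat 1 - t *\<^sub>R N) = mat 1"
    "(mat 1 - t *\<^sub>R N) ** (mat 1 + t *\<^sub>R N) = mat 1"
proof -
  have *: "(mat 1 + t *\<^sub>R N) ** (mat 1 + (- t) *\<^sub>R N) = mat 1" for t
    using assms by (simp add: matrix_distribs square_zero_def)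
  show "(mat 1 + t *\<^sub>R N) ** (mat 1 - t *\<^sub>R N) = mat 1" using *[of t] by simp
  show "(mat 1 - t *\<^sub>R N) ** (mat 1 + t *\<^sub>R N) = mat 1" using *[of "- t"] by simp
qed

text \<open>Every traceless matrix is a sum of five square-zero ones. No clause for scalars appears,
  since they are absorbed into the entries of the summands.\<close>

lemma sl3_square_zero_induct [case_names square_zero add]:
  assumes sq: "\<And>X. square_zero (mat_of_sl3 X) \<Longrightarrow> P X"
    and add: "\<And>X Y. P X \<Longrightarrow> P Y \<Longrightarrow> P (X + Y)"
  shows "P X"
proof -
  define A where "A = mat_of_sl3 X"
  define B where "B i j = A $ i $ j" for i j
  have tr: "B 1 1 + B 2 2 + B 3 3 = 0"
    using mat_of_sl3[of X] by (simp add: A_def B_def trace_def sum_3)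
  define a b where "a = B 1 1" and "b = B 2 2"
  define N where "N = (\<lambda>n::nat. (if n = 0 then vector [vector [0, B 1 2, B 1 3 + a], 0, 0]
    else if n = 1 then vector [0, vector [B 2 1, 0, B 2 3 + b], 0]
    else if n = 2 then vector [0, 0, vector [B 3 1 - a, B 3 2 - b, 0]]
    else if n = 3 then vector [vector [a, 0, - a], 0, vector [a, 0, - a]]
    else vector [0, vector [0, b, - b], vector [0, b, - b]]) :: complex^3^3)"
  have N: "square_zero (N n)" "trace (N n) = 0" for n
    unfolding square_zero_def N_def trace_def
    by (auto simp: matrix_matrix_mult_def vec_eq_iff forall_3 sum_3 det_3 mat_def vector_3
        scaleR_conv_of_real[where 'a = complex] algebra_simps)
  define X' where "X' n = sl3_of_mat (N n)" for n
  have X': "mat_of_sl3 (X' n) = N n" for n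
    unfolding X'_def using N(2) by (intro sl3_of_mat_inverse) auto
  have "P (X' n)" for n
    using sq[of "X' n"] N(1)[of n] by (simp add: X')
  then have "P (X' 0 + X' 1 + X' 2 + X' 3 + X' 4)" by (intro add)
  also have "X' 0 + X' 1 + X' 2 + X' 3 + X' 4 = X"
  proof -
    have "B 3 3 = (B 1 1 + B 2 2 + B 3 3) - a - b" by (simp add: a_def b_def)
    then have "B 3 3 = - a - b" unfolding tr by simp
    then have "A = N 0 + N 1 + N 2 + N 3 + N 4"
      by (auto simp: N_def vec_eq_iff forall_3 vector_3 a_def b_def simp flip: B_def)
    then show ?thesis
      unfolding mat_of_sl3_inject[symmetric] plus_sl3.rep_eq X' A_def by simp
  qed
  finally show ?thesis .
qed

text \<open>Conjugation by any complex g, with its inverse h as an argument. The matrices 1 + t N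
  are not rotations, so \<open>conj_sl3\<close> does not cover them.\<close>

definition conj_by :: "complex^3^3 \<Rightarrow> complex^3^3 \<Rightarrow> sl3 \<Rightarrow> sl3" where
  "conj_by g h X = sl3_of_mat (g ** mat_of_sl3 X ** h)"

lemma mat_of_conj_by:
  assumes "h ** g = mat 1"
  shows "mat_of_sl3 (conj_by g h X) = g ** mat_of_sl3 X ** h"
proof -
  have "trace (g ** mat_of_sl3 X ** h) = trace (mat_of_sl3 X)"
    using assms by (metis trace_mul_sym matrix_mul_assoc matrix_mul_lid)
  then show ?thesis
    unfolding conj_by_def using mat_of_sl3[of X] by (simp add: sl3_of_mat_inverse)
qed

lemma conj_by_add:
  assumes "h ** g = mat 1"
  shows "conj_by g h (X + Y) = conj_by g h X + conj_by g h Y"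
  unfolding mat_of_sl3_inject[symmetric] mat_of_conj_by[OF assms] plus_sl3.rep_eq
  by (simp add: matrix_matrix_mult_def vec_eq_iff sum_3 algebra_simps)

section \<open>Differentiating the group action\<close>

locale sl3_integration =
  fixes lam :: weight and p :: "complex^3^3 \<Rightarrow> gt_vec \<Rightarrow> gt_vec"
  assumes p: "integrates lam p"
begin

lemma linear_p: "det g = 1 \<Longrightarrow> linear_on_V lam (p g)"
  using p unfolding integrates_def linear_on_V_def by blast

lemma p_in_V: "det g = 1 \<Longrightarrow> v \<in> V_space lam \<Longrightarrow> p g v \<in> V_space lam"
  using linear_p unfolding linear_on_V_def by blast

lemma p_one: "v \<in> V_space lam \<Longrightarrow> p (mat 1) v = v"
  using p unfolding integrates_def by blast

lemma p_mult: "det g = 1 \<Longrightarrow> det h = 1 \<Longrightarrow> v \<in> V_space lam \<Longrightarrow> p (g ** h) v = p g (p h v)"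
  using p unfolding integrates_def by blast

lemma p_derivative:
  assumes "square_zero (mat_of_sl3 X)" "v \<in> V_space lam"
  shows "((\<lambda>t. p (mat 1 + t *\<^sub>R mat_of_sl3 X) v M) has_vector_derivative rho lam X v M) (at 0)"
proof -
  define c where "c t = mat 1 + t *\<^sub>R mat_of_sl3 X" for t :: real
  have "(c has_vector_derivative mat_of_sl3 X) (at 0)"
    unfolding c_def by (auto intro!: derivative_eq_intros)
  moreover have "\<forall>t. det (c t) = 1" "c 0 = mat 1"
    using assms(1) by (simp_all add: square_zero_def c_def)
  ultimately have "((\<lambda>t. p (c t) v M) has_vector_derivative rho lam X v M) (at 0)"
    using p assms(2) unfolding integrates_def by blast
  then show ?thesis by (simp add: c_def)
qed

text \<open>Both sides are the derivative at \<open>0\<close> of \<open>p (g (1 + t X) h) (p g v) = p g (p (1 + t X) v)\<close>,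
  first for \<open>X\<close> of square zero.\<close>

lemma p_rho:
  assumes gh: "g ** h = mat 1" "h ** g = mat 1" "det g = 1" and v: "v \<in> V_space lam"
  shows "p g (rho lam X v) = rho lam (conj_by g h X) (p g v)"
proof (induction X rule: sl3_square_zero_induct)
  case (add X Y)
  have "p g (rho lam (X + Y) v) = p g (rho lam X v) + p g (rho lam Y v)"
    unfolding rho_add using linear_p[OF gh(3)] unfolding linear_on_V_def by (metis rho_in_V)
  then show ?case unfolding add conj_by_add[OF gh(2)] rho_add[of lam "conj_by g h X"] .
next
  case (square_zero X)
  define N where "N = mat_of_sl3 X"
  have N': "mat_of_sl3 (conj_by g h X) = g ** N ** h" by (simp add: N_def mat_of_conj_by gh)
  have sq': "square_zero (mat_of_sl3 (conj_by g h X))"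
    unfolding N' using square_zero gh by (simp add: square_zero_conj N_def)
  have det1: "det (mat 1 + t *\<^sub>R N) = 1" for t using square_zero by (simp add: square_zero_def N_def)
  have deth: "det h = 1"
    using gh(1,3) by (metis det_I det_mul mult_1)
  show ?case
  proof
    fix M
    have "((\<lambda>t. p (mat 1 + t *\<^sub>R (g ** N ** h)) (p g v) M) has_vector_derivative
        rho lam (conj_by g h X) (p g v) M) (at 0)"
      using p_derivative[OF sq' p_in_V[OF gh(3) v]] unfolding N' .
    moreover have "p (mat 1 + t *\<^sub>R (g ** N ** h)) (p g v) = p g (p (mat 1 + t *\<^sub>R N) v)" for t
    proof -
      have "p (mat 1 + t *\<^sub>R (g ** N ** h)) (p g v) = p (g ** (mat 1 + t *\<^sub>R N) ** h ** g) v"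
        using gh v det1 deth by (simp add: mat_1_scaleR_conj p_mult det_mul flip: mat_1_scaleR_conj)
      also have "g ** (mat 1 + t *\<^sub>R N) ** h ** g = g ** (mat 1 + t *\<^sub>R N)"
        using gh by (metis matrix_mul_assoc matrix_mul_rid)
      finally show ?thesis using gh v det1 by (simp add: p_mult)
    qed
    ultimately have 1: "((\<lambda>t. p g (p (mat 1 + t *\<^sub>R N) v) M) has_vector_derivative
        rho lam (conj_by g h X) (p g v) M) (at 0)"
      by simp
    \<comment> \<open>Linearity turns \<open>p g\<close> into a finite sum with constant weights
      \<open>p g (xi lam L) M\<close>, so the derivative passes inside and yields a second value for
      the one found above.\<close>
    have expand: "p g w M = (\<Sum>L\<in>GT_patterns lam. w L * p g (xi lam L) M)" if "w \<in> V_space lam" for w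
      using linear_on_V_expand[OF linear_p[OF gh(3)] that] by (simp add: gt_sum_apply)
    have "((\<lambda>t. \<Sum>L\<in>GT_patterns lam. p (mat 1 + t *\<^sub>R N) v L * p g (xi lam L) M)
        has_vector_derivative (\<Sum>L\<in>GT_patterns lam. rho lam X v L * p g (xi lam L) M)) (at 0)"
      using p_derivative[OF square_zero v] unfolding N_def
      by (intro has_vector_derivative_sum has_vector_derivative_mult_left)
    then have 2: "((\<lambda>t. p g (p (mat 1 + t *\<^sub>R N) v) M) has_vector_derivative
        p g (rho lam X v) M) (at 0)"
      using v det1 by (simp add: expand p_in_V)
    show "p g (rho lam X v) M = rho lam (conj_by g h X) (p g v) M"
      using vector_derivative_unique_at[OF 2 1] .
  qed
qed

text \<open>The derivative at \<open>t = 0\<close> of \<open>p_rho\<close> for \<open>g = 1 + t Y\<close>.\<close>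

lemma rho_bracket_square_zero:
  assumes Y: "square_zero (mat_of_sl3 Y)" and v: "v \<in> V_space lam"
  shows "rho lam Y (rho lam X v) = rho lam (sl3_bracket Y X) v + rho lam X (rho lam Y v)"
proof
  fix M
  define N where "N = mat_of_sl3 Y"
  define A where "A = mat_of_sl3 X"
  define c where "c t = mat 1 + t *\<^sub>R N" for t :: real
  define d where "d t = mat 1 - t *\<^sub>R N" for t :: real
  define Z where "Z t = conj_by (c t) (d t) X" for t :: real
  have cd: "c t ** d t = mat 1" "d t ** c t = mat 1" "det (c t) = 1" for t
    unfolding c_def d_def N_def using square_zero_inverse[OF Y] Y[unfolded square_zero_def] by blast+
  have c0: "c 0 = mat 1" by (simp add: c_def)
  have Z0: "Z 0 = X"
    unfolding mat_of_sl3_inject[symmetric] Z_def mat_of_conj_by[OF cd(2)]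
    by (simp add: c_def d_def)
  have dp: "((\<lambda>t. p (c t) w K) has_vector_derivative rho lam Y w K) (at 0)"
    if "w \<in> V_space lam" for w K
    using p_derivative[OF Y that] unfolding c_def N_def .
  \<comment> \<open>(1 + t N) A (1 - t N) is quadratic in t, and its linear coefficient is the
    bracket of N and A.\<close>
  have "mat_of_sl3 (Z t) = A + t *\<^sub>R (N ** A - A ** N) - (t * t) *\<^sub>R (N ** A ** N)" for t
    unfolding Z_def mat_of_conj_by[OF cd(2)] A_def[symmetric] unfolding c_def d_def
    by (simp add: matrix_distribs algebra_simps)
  then have Zij: "mat_of_sl3 (Z t) $ i $ j
      = A $ i $ j + t *\<^sub>R (N ** A - A ** N) $ i $ j - (t * t) *\<^sub>R (N ** A ** N) $ i $ j" for t i j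
    by simp
  have "((\<lambda>t. mat_of_sl3 (Z t) $ i $ j) has_vector_derivative (N ** A - A ** N) $ i $ j) (at 0)" for i j
    unfolding Zij has_vector_derivative_def
    by (auto intro!: derivative_eq_intros simp: algebra_simps)
  then have dZ: "((\<lambda>t. rho lam (Z t) w M) has_vector_derivative rho lam (sl3_bracket Y X) w M) (at 0)" for w
    unfolding rho_def gt_sum_apply vscale_apply sl3_bracket.rep_eq N_def[symmetric] A_def[symmetric]
    by (intro has_vector_derivative_sum has_vector_derivative_mult_left)
  have expand: "rho lam W w M = (\<Sum>L\<in>GT_patterns lam. w L * rho lam W (xi lam L) M)"
    if "w \<in> V_space lam" for w W
    using linear_on_V_expand[OF gt_operator_linear_on_V[OF gt_operator_rho] that]
    by (simp add: gt_sum_apply)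
  \<comment> \<open>Product rule: both the vector \<open>p (c t) v\<close> and the operator
    \<open>rho lam (Z t)\<close> vary with t. At t = 0 they are v and
    \<open>rho lam X\<close>.\<close>
  have "((\<lambda>t. \<Sum>L\<in>GT_patterns lam. p (c t) v L * rho lam (Z t) (xi lam L) M) has_vector_derivative
      (\<Sum>L\<in>GT_patterns lam. p (c 0) v L * rho lam (sl3_bracket Y X) (xi lam L) M
         + rho lam Y v L * rho lam (Z 0) (xi lam L) M)) (at 0)"
    using dp[OF v] dZ by (intro has_vector_derivative_sum has_vector_derivative_mult)
  then have "((\<lambda>t. rho lam (Z t) (p (c t) v) M) has_vector_derivative
      (rho lam (sl3_bracket Y X) v M + rho lam X (rho lam Y v) M)) (at 0)"
    using v cd by (simp add: expand p_in_V c0 Z0 p_one sum.distrib)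
  \<comment> \<open>By \<open>p_rho\<close> the same curve is \<open>p (c t)\<close> applied to a
    fixed vector, so its derivative is also \<open>rho lam Y (rho lam X v)\<close>.\<close>
  moreover have "rho lam (Z t) (p (c t) v) = p (c t) (rho lam X v)" for t
    unfolding Z_def using p_rho[OF cd v] by simp
  ultimately have "((\<lambda>t. p (c t) (rho lam X v) M) has_vector_derivative
      (rho lam (sl3_bracket Y X) v M + rho lam X (rho lam Y v) M)) (at 0)"
    by simp
  then show "rho lam Y (rho lam X v) M = (rho lam (sl3_bracket Y X) v + rho lam X (rho lam Y v)) M"
    using vector_derivative_unique_at[OF dp[of "rho lam X v" M]] by simp
qed

text \<open>This is what makes \<open>act\<close> independent of the representative, through
  \<open>free_act_cong\<close>; all rules for \<open>act\<close> of sums and products below rest on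
  it.\<close>

lemma sl3_rep_rho: "sl3_rep (rho lam)"
proof -
  have V: "rho lam Y (rho lam X v) = rho lam (sl3_bracket Y X) v + rho lam X (rho lam Y v)"
    if v: "v \<in> V_space lam" for X Y v
  proof (induction Y rule: sl3_square_zero_induct)
    case (square_zero Y)
    then show ?case by (rule rho_bracket_square_zero[OF _ v])
  next
    case (add Y Y')
    have "sl3_bracket (Y + Y') X = sl3_bracket Y X + sl3_bracket Y' X"
      unfolding mat_of_sl3_inject[symmetric] sl3_bracket.rep_eq plus_sl3.rep_eq
      by (simp add: matrix_matrix_mult_def vec_eq_iff sum_3 algebra_simps)
    then show ?case
      unfolding rho_add vlinear_add[OF vlinear_rho] add by (simp only: rho_add ac_simps)
  qed
  \<comment> \<open>\<open>sl3_rep\<close> asks for arbitrary v, but both sides depend only on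
    \<open>restr lam v\<close>, which lies in the module.\<close>
  have "rho lam (sl3_bracket Y X) v = commutator (rho lam Y) (rho lam X) v" for X Y v
    using V[of "restr lam v" Y X] by (simp add: commutator_def rho_restr)
  then show ?thesis
    by (simp add: sl3_rep_def vlinear_rho rho_add rho_sl3_scale fun_eq_iff)
qed

end

section \<open>Operators of the enveloping algebra\<close>

lemma free_act_free_map: "free_act r (free_map f q) v = free_act (\<lambda>X. r (f X)) q v"
proof (induction q rule: free_sl3_induct)
  case (single w c)
  then show ?case by (simp add: free_map_single free_act_single foldr_map comp_def)
qed (simp_all only: free_map_zero free_map_add free_act_zero free_act_add)

text \<open>T moves past a word one letter at a time. Since \<open>Tr\<close> is available only on
  the module, the induction also carries the fact that \<open>free_act r q v\<close> stays
  there.\<close>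

lemma free_act_intertwine:
  assumes T: "linear_on_V lam T"
    and r: "\<And>X v. v \<in> V_space lam \<Longrightarrow> r X v \<in> V_space lam"
    and Tr: "\<And>X v. v \<in> V_space lam \<Longrightarrow> T (r X v) = r' X (T v)"
    and v: "v \<in> V_space lam"
  shows "T (free_act r q v) = free_act r' q (T v)"
proof -
  have "free_act r q v \<in> V_space lam \<and> T (free_act r q v) = free_act r' q (T v)"
  proof (induction q rule: free_sl3_induct)
    case zero
    then show ?case by (simp only: free_act_zero V_space_0 linear_on_V_0[OF T])
  next
    case (single w c)
    have "foldr r xs v \<in> V_space lam \<and> T (foldr r xs v) = foldr r' xs (T v)" for xs
      by (induction xs) (auto simp: v r Tr)
    then show ?case
      using T unfolding free_act_single linear_on_V_def by (metis V_space_vscale)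
  next
    case (add p q)
    then show ?case
      unfolding free_act_add using T V_space_add unfolding linear_on_V_def by metis
  qed
  then show ?thesis ..
qed

lemma det_cmat: "det (cmat R) = of_real (det R)"
  by (simp add: det_3 cmat_def)

section \<open>Intertwining relations for the enveloping algebra\<close>

context sl3_integration
begin

lemma act_abs: "act lam (abs_usl3 q) = free_act (rho lam) q"
  unfolding act_def
  by (rule free_act_cong[OF sl3_rep_rho]) (rule Quotient3_abs_rep[OF Quotient3_usl3])

lemma act_add: "act lam (u + w) v = act lam u v + act lam w v"
  by (induct u rule: usl3.abs_induct; induct w rule: usl3.abs_induct)
     (simp only: plus_usl3.abs_eq act_abs free_act_add)

lemma act_diff: "act lam (u - w) v = act lam u v - act lam w v"
  by (metis act_add add_diff_cancel diff_add_cancel)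

lemma act_mult: "act lam (u * w) v = act lam u (act lam w v)"
  by (induct u rule: usl3.abs_induct; induct w rule: usl3.abs_induct)
     (simp only: times_usl3.abs_eq act_abs free_act_mult vlinear_rho simp_thms)

lemma act_scale: "act lam (usl3_scale c u) v = c \<cdot> act lam u v"
  by (induct u rule: usl3.abs_induct)
     (simp only: usl3_scale.abs_eq act_abs free_act_mult vlinear_rho free_act_const simp_thms)

lemma act_gen: "act lam (usl3_gen X) v = rho lam X v"
  unfolding usl3_gen.abs_eq act_abs free_act_single by (simp add: vscale_simps)

lemma act_sum: "act lam (\<Sum>a\<in>A. f a) v = (\<Sum>a\<in>A. act lam (f a) v)"
proof (induction A rule: infinite_finite_induct)
  case (insert x F)
  then show ?case by (simp only: sum.insert act_add simp_thms)
\<comment> \<open>An infinite or empty sum is 0 = u - u, on which \<open>act_diff\<close> gives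
  0.\<close>
qed (metis act_diff diff_self sum.infinite, metis act_diff diff_self sum.empty)

lemma vlinear_act: "vlinear (act lam u)"
  unfolding act_def using vlinear_rho by (intro vlinear_free_act) blast

lemma act_in_V: "v \<in> V_space lam \<Longrightarrow> act lam u v \<in> V_space lam"
proof (induct u rule: usl3.abs_induct)
  case (1 q)
  have "foldr (rho lam) xs v \<in> V_space lam" for xs
    using 1 by (induction xs) auto
  then show ?case
    unfolding act_abs free_act_def by (intro V_space_sum V_space_vscale)
qed

text \<open>The right side evaluates the very representative that \<open>act lam u\<close> uses,
  only with twisted letters. The two can therefore be compared word by word with
  \<open>free_act_intertwine\<close>.\<close>

lemma act_Psi: "act lam (Psi R u) v = free_act (\<lambda>X. rho lam (conj_sl3 R X)) (rep_usl3 u) v"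
  by (simp only: Psi_def usl3_map_def act_abs free_act_free_map)

lemma rotation_facts:
  assumes S: "rotation_matrix S"
  shows "cmat S ** cmat (matrix_inv S) = mat 1" "cmat (matrix_inv S) ** cmat S = mat 1"
    "det (cmat (matrix_inv S)) = 1"
  using S by (auto simp: rotation_matrix_inv rotation_matrix_def orthogonal_matrix_def det_cmat
      cmat_1 simp flip: cmat_mult)

lemma conj_by_inverse:
  assumes "g ** h = mat 1" "h ** g = mat 1"
  shows "conj_by h g (conj_by g h X) = X"
proof -
  have "h ** (g ** mat_of_sl3 X ** h) ** g = (h ** g) ** mat_of_sl3 X ** (h ** g)"
    by (simp only: matrix_mul_assoc)
  then show ?thesis
    unfolding mat_of_sl3_inject[symmetric] mat_of_conj_by[OF assms(1)] mat_of_conj_by[OF assms(2)]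
    by (simp add: assms)
qed

text \<open>\<open>p_rho\<close> for S^-1 is applied to S X S^-1, which conjugation by S^-1 turns
  back into X.\<close>

lemma p_act_recurrence:
  assumes S: "rotation_matrix S" and v: "v \<in> V_space lam"
  shows "p (cmat (matrix_inv S)) (act lam (Psi S u) v) = act lam u (p (cmat (matrix_inv S)) v)"
proof -
  note R = rotation_facts[OF S]
  have "p (cmat (matrix_inv S)) (rho lam (conj_sl3 S X) w) = rho lam X (p (cmat (matrix_inv S)) w)"
    if "w \<in> V_space lam" for X w
    using p_rho[OF R(2,1,3) that, of "conj_sl3 S X"]
      conj_by_inverse[OF R(1,2), of X] by (simp only: conj_sl3_def conj_by_def)
  then show ?thesis
    unfolding act_Psi unfolding act_def
    by (intro free_act_intertwine[OF linear_p[OF R(3)] _ _ v]) auto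
qed

text \<open>Here \<open>p_rho\<close> is applied to X itself, and conjugation by S^-1 is
  \<open>conj_sl3 (transpose S)\<close> because S^-1 = S^t.\<close>

lemma p_act_difference:
  assumes S: "rotation_matrix S" and v: "v \<in> V_space lam"
  shows "p (cmat (matrix_inv S)) (act lam u v) =
    act lam (Psi (transpose S) u) (p (cmat (matrix_inv S)) v)"
proof -
  note R = rotation_facts[OF S]
  have "rotation_matrix (transpose S)"
    using S by (simp add: rotation_matrix_def)
  then have "conj_sl3 (transpose S) X = conj_by (cmat (matrix_inv S)) (cmat S) X" for X
    by (simp add: conj_sl3_def conj_by_def rotation_matrix_inv S)
  then have "p (cmat (matrix_inv S)) (rho lam X w) =
      rho lam (conj_sl3 (transpose S) X) (p (cmat (matrix_inv S)) w)"
    if "w \<in> V_space lam" for X w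
    using p_rho[OF R(2,1,3) that, of X] by simp
  then show ?thesis
    unfolding act_Psi unfolding act_def
    by (intro free_act_intertwine[OF linear_p[OF R(3)] _ _ v]) auto
qed

end

section \<open>Explicit action on the basis\<close>

lemma xi_notin: "L \<notin> GT_patterns lam \<Longrightarrow> xi lam L = 0"
  by (auto simp: xi_def fun_eq_iff)

lemma lin_ext_xi: "lin_ext lam f (xi lam L) = (if L \<in> GT_patterns lam then f L else 0)"
proof -
  have "lin_ext lam f (xi lam L) = (\<Sum>M\<in>GT_patterns lam. if M = L then f L else 0)"
    unfolding lin_ext_def by (intro sum.cong) (auto simp: xi_def vscale_simps)
  then show ?thesis by (simp add: finite_GT_patterns)
qed

lemma GT_patterns_iff:
  "(l11, l21, l22) \<in> GT_patterns (l31, l32, l33) \<longleftrightarrow>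
     l31 - l21 \<in> \<nat> \<and> l21 - l32 \<in> \<nat> \<and> l32 - l22 \<in> \<nat> \<and> l22 - l33 \<in> \<nat> \<and>
     l21 - l11 \<in> \<nat> \<and> l11 - l22 \<in> \<nat>"
  by (simp add: GT_patterns_def)

lemma minus_1_notin_Nats: "- 1 \<notin> (\<nat> :: complex set)"
proof
  assume "- 1 \<in> (\<nat> :: complex set)"
  then obtain n where "(- 1 :: complex) = of_nat n" by (rule Nats_cases)
  then have "(of_nat (n + 1) :: complex) = of_nat 0" by (simp add: eq_neg_iff_add_eq_0[symmetric] minus_equation_iff)
  then show False by (simp only: of_nat_eq_iff)
qed

lemma gt_e_simps:
  "gt_e lam 1 1 = gt11 lam" "gt_e lam 2 2 = gt22 lam" "gt_e lam 3 3 = gt33 lam"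
  "gt_e lam 1 2 = gt12 lam" "gt_e lam 2 1 = gt21 lam" "gt_e lam 2 3 = gt23 lam"
  "gt_e lam 3 2 = gt32 lam"
  "gt_e lam 1 3 = commutator (gt12 lam) (gt23 lam)"
  "gt_e lam 3 1 = commutator (gt32 lam) (gt21 lam)"
  by (simp_all add: gt_e_def)

lemma gt_e_xi:
  assumes L: "(l11, l21, l22) \<in> GT_patterns (l31, l32, l33)"
  defines "M \<equiv> (l11, l21, l22)" and "lam \<equiv> (l31, l32, l33)"
  shows "gt_e lam 1 1 (xi lam M) = l11 \<cdot> xi lam M"
    "gt_e lam 2 2 (xi lam M) = (l21 + l22 - l11) \<cdot> xi lam M"
    "gt_e lam 3 3 (xi lam M) = (- (l21 + l22)) \<cdot> xi lam M"
    "gt_e lam 1 2 (xi lam M) = ((l21 - l11) * (l11 - l22 + 1)) \<cdot> xi lam (M + d11)"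
    "gt_e lam 2 1 (xi lam M) = xi lam (M - d11)"
    "gt_e lam 2 3 (xi lam M) =
       ((l31 - l21) / (l21 - l22 + 1)) \<cdot> xi lam (M + d21)
     + ((l31 - l22 + 1) / (l21 - l22 + 1)) \<cdot> xi lam (M + d22)"
    "gt_e lam 3 2 (xi lam M) =
       ((l21 - l32) * (l21 - l33 + 1) * (l21 - l11) / (l21 - l22 + 1)) \<cdot> xi lam (M - d21)
     + ((l11 - l22 + 1) * (l32 - l22 + 1) * (l22 - l33) / (l21 - l22 + 1)) \<cdot> xi lam (M - d22)"
  using L
  by (simp_all only: gt_e_simps gt11_def gt22_def gt33_def gt12_def gt21_def gt23_def gt32_def
      lin_ext_xi M_def lam_def prod.case if_True simp_thms)

lemma vlinear_gt_e: "vlinear (gt_e lam i j)"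
  using gt_operator_gt_e[of lam i j] by (simp only: gt_operator_def)

lemma gt_pattern_shifts:
  "(a, b, c) + d11 = (a + 1, b, c)" "(a, b, c) - d11 = (a - 1, b, c)"
  "(a, b, c) + d21 = (a, b + 1, c)" "(a, b, c) - d21 = (a, b - 1, c)"
  "(a, b, c) + d22 = (a, b, c + 1)" "(a, b, c) - d22 = (a, b, c - 1)"
  by (simp_all add: d11_def d21_def d22_def)

lemma vscale_eq_0: "c = 0 \<or> v = 0 \<Longrightarrow> c \<cdot> v = 0"
  by (auto simp: vscale_simps)

text \<open>The gaps are naturals, so a unit shift leaves the patterns only where some gap is 0.
  Each alternative to membership names a factor that vanishes in the action formulas or a doubly
  shifted triple that is missing too. The first three serve e_13, the last three e_31.\<close>

lemma GT_pattern_neighbours: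
  assumes L: "(l11, l21, l22) \<in> GT_patterns (l31, l32, l33)"
  defines "M \<equiv> (l11, l21, l22)" and "P \<equiv> GT_patterns (l31, l32, l33)"
  shows "M + d11 \<in> P \<or> l21 = l11"
    "M + d21 \<in> P \<or> M + d11 + d21 \<notin> P"
    "M + d22 \<in> P \<or> M + d11 + d22 \<notin> P \<or> l11 = l22"
    "M - d11 \<in> P \<or> l11 = l22 \<and> M - d11 - d21 \<notin> P"
    "M - d21 \<in> P \<or> l21 = l32 \<or> l21 = l11"
    "M - d22 \<in> P \<or> l22 = l33"
proof -
  note N = L[unfolded GT_patterns_iff]
  have plus: "x - y + 1 \<in> \<nat>" if "x - y \<in> \<nat>" for x y :: complex
    using Nats_add[OF that Nats_1] .
  have minus: "x - y - 1 \<in> \<nat>" if "x - y \<in> \<nat>" "x \<noteq> y" for x y :: complex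
    using Nats_minus_1[OF that(1)] that(2) by simp
  have "x - (y + 1) = x - y - 1" "x + 1 - y = x - y + 1" "x - (y - 1) = x - y + 1"
    "x - 1 - y = x - y - 1" for x y :: complex
    by simp_all
  note norm = this
  show "M + d11 \<in> P \<or> l21 = l11"
    using N plus[of l11 l22] minus[of l21 l11]
    by (auto simp only: M_def P_def gt_pattern_shifts GT_patterns_iff norm)
  show "M + d21 \<in> P \<or> M + d11 + d21 \<notin> P"
    using N plus[of l21 l32] plus[of l21 l11]
    by (auto simp only: M_def P_def gt_pattern_shifts GT_patterns_iff norm)
  show "M + d22 \<in> P \<or> M + d11 + d22 \<notin> P \<or> l11 = l22"
    using N plus[of l22 l33] minus[of l11 l22]
    by (auto simp only: M_def P_def gt_pattern_shifts GT_patterns_iff norm)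
  show "M - d11 \<in> P \<or> l11 = l22 \<and> M - d11 - d21 \<notin> P"
    using N plus[of l21 l11] minus[of l11 l22] minus_1_notin_Nats
    by (auto simp add: M_def P_def gt_pattern_shifts GT_patterns_iff norm simp del: diff_add_eq)
  show "M - d21 \<in> P \<or> l21 = l32 \<or> l21 = l11"
    using N plus[of l31 l21] minus[of l21 l32] minus[of l21 l11]
    by (auto simp only: M_def P_def gt_pattern_shifts GT_patterns_iff norm)
  show "M - d22 \<in> P \<or> l22 = l33"
    using N plus[of l32 l22] plus[of l11 l22] minus[of l22 l33]
    by (auto simp only: M_def P_def gt_pattern_shifts GT_patterns_iff norm)
qed

text \<open>Each target is reached along two paths. For d11 + d21 the e_12 factors differ by (l21 +
  1 - l11) - (l21 - l11) = 1 times l11 - l22 + 1; for d11 + d22 by (l11 - l22) - (l11 - l22 + 1) =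
  -1 times l21 - l11.\<close>

lemma gt13_xi:
  assumes L: "(l11, l21, l22) \<in> GT_patterns (l31, l32, l33)"
  defines "M \<equiv> (l11, l21, l22)" and "lam \<equiv> (l31, l32, l33)"
  shows "gt_e lam 1 3 (xi lam M) =
      ((l11 - l22 + 1) * (l31 - l21) / (l21 - l22 + 1)) \<cdot> xi lam (M + d11 + d21)
    - ((l21 - l11) * (l31 - l22 + 1) / (l21 - l22 + 1)) \<cdot> xi lam (M + d11 + d22)"
proof -
  note nb = GT_pattern_neighbours[OF L, folded M_def lam_def]
  note act = gt_e_xi[of _ _ _ l31 l32 l33, folded lam_def]
  \<comment> \<open>A shift by d11 keeps l21 - l22, so both orders of the product share this
    denominator and it never has to be cancelled.\<close>
  define D where "D = l21 - l22 + 1"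
  have 1: "gt_e lam 1 2 (xi lam (M + d21)) =
      ((l21 + 1 - l11) * (l11 - l22 + 1)) \<cdot> xi lam (M + d11 + d21)"
  proof (cases "M + d21 \<in> GT_patterns lam")
    case True
    then show ?thesis using act(4)[of l11 "l21 + 1" l22] by (simp add: M_def gt_pattern_shifts)
  next
    case False
    then show ?thesis
      using nb(2) by (simp add: xi_notin vscale_eq_0 vlinear_0[OF vlinear_gt_e])
  qed
  have 2: "gt_e lam 1 2 (xi lam (M + d22)) =
      ((l21 - l11) * (l11 - l22)) \<cdot> xi lam (M + d11 + d22)"
  proof (cases "M + d22 \<in> GT_patterns lam")
    case True
    then show ?thesis using act(4)[of l11 l21 "l22 + 1"] by (simp add: M_def gt_pattern_shifts)
  next
    case False
    then have "M + d11 + d22 \<notin> GT_patterns lam \<or> l11 = l22" using nb(3) by blast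
    with False show ?thesis
      by (auto simp: xi_notin vlinear_0[OF vlinear_gt_e] vscale_eq_0)
  qed
  \<comment> \<open>Claimed only with the scalar in front: if l21 = l11, then M + d11 is missing
    while M + d11 + d21 may be a pattern, and the scalar vanishes.\<close>
  have 3: "((l21 - l11) * (l11 - l22 + 1)) \<cdot> gt_e lam 2 3 (xi lam (M + d11)) =
      ((l21 - l11) * (l11 - l22 + 1)) \<cdot> (((l31 - l21) / D) \<cdot> xi lam (M + d11 + d21)
        + ((l31 - l22 + 1) / D) \<cdot> xi lam (M + d11 + d22))"
  proof (cases "M + d11 \<in> GT_patterns lam")
    case True
    then show ?thesis
      using act(6)[of "l11 + 1" l21 l22] by (simp add: M_def gt_pattern_shifts D_def)
  next
    case False
    then have "l21 - l11 = 0" using nb(1) by auto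
    then show ?thesis by (simp only: mult_zero_left vscale_simps add_0)
  qed
  have "gt_e lam 1 3 (xi lam M) =
      ((l31 - l21) / D) \<cdot> ((l21 + 1 - l11) * (l11 - l22 + 1)) \<cdot> xi lam (M + d11 + d21)
    + ((l31 - l22 + 1) / D) \<cdot> ((l21 - l11) * (l11 - l22)) \<cdot> xi lam (M + d11 + d22)
    - ((l21 - l11) * (l11 - l22 + 1)) \<cdot> (((l31 - l21) / D) \<cdot> xi lam (M + d11 + d21)
        + ((l31 - l22 + 1) / D) \<cdot> xi lam (M + d11 + d22))"
    unfolding gt_e_simps commutator_def
    unfolding gt_e_simps(4,6)[symmetric] gt_e_xi[OF L, folded M_def lam_def]
      vlinear_add[OF vlinear_gt_e] vlinear_vscale[OF vlinear_gt_e] 1 2 3 D_def ..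
  then show ?thesis
    unfolding D_def[symmetric]
    by (auto simp: fun_eq_iff divide_inverse algebra_simps)
qed

text \<open>Again two paths per target: (l21 - l11 + 1) - (l21 - l11) = 1 removes the factor l21 -
  l11, and (l11 - l22) - (l11 - l22 + 1) = -1 gives the minus sign.\<close>

lemma gt31_xi:
  assumes L: "(l11, l21, l22) \<in> GT_patterns (l31, l32, l33)"
  defines "M \<equiv> (l11, l21, l22)" and "lam \<equiv> (l31, l32, l33)"
  shows "gt_e lam 3 1 (xi lam M) =
      ((l21 - l32) * (l21 - l33 + 1) / (l21 - l22 + 1)) \<cdot> xi lam (M - d11 - d21)
    - ((l32 - l22 + 1) * (l22 - l33) / (l21 - l22 + 1)) \<cdot> xi lam (M - d11 - d22)"
proof -
  note nb = GT_pattern_neighbours[OF L, folded M_def lam_def]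
  note act = gt_e_xi[of _ _ _ l31 l32 l33, folded lam_def]
  define D where "D = l21 - l22 + 1"
  have 1: "gt_e lam 3 2 (xi lam (M - d11)) =
      ((l21 - l32) * (l21 - l33 + 1) * (l21 - l11 + 1) / D) \<cdot> xi lam (M - d11 - d21)
    + ((l11 - l22) * (l32 - l22 + 1) * (l22 - l33) / D) \<cdot> xi lam (M - d11 - d22)"
  proof (cases "M - d11 \<in> GT_patterns lam")
    case True
    then show ?thesis
      using act(7)[of "l11 - 1" l21 l22] by (simp add: M_def gt_pattern_shifts D_def algebra_simps)
  next
    case False
    then have "l11 - l22 = 0" "M - d11 - d21 \<notin> GT_patterns lam" using nb(4) by auto
    with False show ?thesis
      by (simp add: xi_notin vlinear_0[OF vlinear_gt_e] vscale_eq_0)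
  qed
  \<comment> \<open>The scalar is needed here as well: for l21 = l11 the triple M - d21 is missing
    while M - d11 - d21 may be a pattern.\<close>
  have 2: "((l21 - l32) * (l21 - l33 + 1) * (l21 - l11) / D) \<cdot> gt_e lam 2 1 (xi lam (M - d21)) =
      ((l21 - l32) * (l21 - l33 + 1) * (l21 - l11) / D) \<cdot> xi lam (M - d11 - d21)"
  proof (cases "M - d21 \<in> GT_patterns lam")
    case True
    then show ?thesis using act(5)[of l11 "l21 - 1" l22] by (simp add: M_def gt_pattern_shifts)
  next
    case False
    then have "(l21 - l32) * (l21 - l33 + 1) * (l21 - l11) / D = 0" using nb(5) by auto
    then show ?thesis by (simp only: vscale_simps)
  qed
  have 3: "((l11 - l22 + 1) * (l32 - l22 + 1) * (l22 - l33) / D) \<cdot> gt_e lam 2 1 (xi lam (M - d22)) =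
      ((l11 - l22 + 1) * (l32 - l22 + 1) * (l22 - l33) / D) \<cdot> xi lam (M - d11 - d22)"
  proof (cases "M - d22 \<in> GT_patterns lam")
    case True
    then show ?thesis using act(5)[of l11 l21 "l22 - 1"] by (simp add: M_def gt_pattern_shifts)
  next
    case False
    then have "(l11 - l22 + 1) * (l32 - l22 + 1) * (l22 - l33) / D = 0" using nb(6) by auto
    then show ?thesis by (simp only: vscale_simps)
  qed
  have "gt_e lam 3 1 (xi lam M) =
      ((l21 - l32) * (l21 - l33 + 1) * (l21 - l11 + 1) / D) \<cdot> xi lam (M - d11 - d21)
    + ((l11 - l22) * (l32 - l22 + 1) * (l22 - l33) / D) \<cdot> xi lam (M - d11 - d22)
    - (((l21 - l32) * (l21 - l33 + 1) * (l21 - l11) / D) \<cdot> xi lam (M - d11 - d21)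
     + ((l11 - l22 + 1) * (l32 - l22 + 1) * (l22 - l33) / D) \<cdot> xi lam (M - d11 - d22))"
    unfolding gt_e_simps commutator_def
    unfolding gt_e_simps(5,7)[symmetric] gt_e_xi[OF L, folded M_def lam_def]
      vlinear_add[OF vlinear_gt_e] vlinear_vscale[OF vlinear_gt_e] D_def[symmetric] 1 2 3 ..
  then show ?thesis
    unfolding D_def[symmetric]
    by (auto simp: fun_eq_iff divide_inverse algebra_simps)
qed

lemma gt_e_trace: "gt_e lam 1 1 v + gt_e lam 2 2 v + gt_e lam 3 3 v = 0"
proof -
  have *: "l11 \<cdot> x + (l21 + l22 - l11) \<cdot> x + (- (l21 + l22)) \<cdot> x = 0" for l11 l21 l22 :: complex and x
    by (simp add: vscale_simps(1)[symmetric] vscale_eq_0)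
  show ?thesis
    unfolding gt_e_simps gt11_def gt22_def gt33_def lin_ext_def
    unfolding sum.distrib[symmetric] vscale_simps(2)[symmetric]
  proof (intro sum.neutral ballI)
    fix L :: gt_pattern
    obtain l11 l21 l22 where L: "L = (l11, l21, l22)" by (cases L)
    show "v L \<cdot> ((case L of (l11, l21, l22) \<Rightarrow> l11 \<cdot> xi lam L)
        + (case L of (l11, l21, l22) \<Rightarrow> (l21 + l22 - l11) \<cdot> xi lam L)
        + (case L of (l11, l21, l22) \<Rightarrow> (- (l21 + l22)) \<cdot> xi lam L)) = 0"
      unfolding L prod.case * vscale_simps ..
  qed
qed

text \<open>\<open>rho\<close> expands a matrix by its entries, so the correction by I/3 in a
  diagonal \<open>e_sl3\<close> contributes a third of e_11 + e_22 + e_33, which acts as 0 by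
  \<open>gt_e_trace\<close>.\<close>

lemma rho_e_sl3: "rho lam (e_sl3 i j) v = gt_e lam i j v"
proof -
  have *: "(\<Sum>k\<in>UNIV. \<Sum>l\<in>UNIV. (mat_unit i j - mat ((if i = j then 1 else 0) / 3)) $ k $ l * g k l)
      = g i j" if "g 1 1 + g 2 2 + g 3 3 = 0" for g :: "3 \<Rightarrow> 3 \<Rightarrow> complex"
  proof -
    have "(\<Sum>k\<in>UNIV. \<Sum>l\<in>UNIV. (mat_unit i j - mat ((if i = j then 1 else 0) / 3)) $ k $ l * g k l)
        = g i j - (if i = j then 1 else 0) / 3 * (g 1 1 + g 2 2 + g 3 3)"
      using exhaust_3[of i] exhaust_3[of j]
      by (elim disjE) (simp_all add: mat_unit_def mat_def sum_3 field_simps)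
    then show ?thesis unfolding that by simp
  qed
  show ?thesis
  proof
    fix M
    show "rho lam (e_sl3 i j) v M = gt_e lam i j v M"
      unfolding rho_def gt_sum_apply vscale_apply e_sl3.rep_eq
      by (rule *[of "\<lambda>k l. gt_e lam k l v M"])
        (use gt_e_trace[of lam v, THEN fun_cong, of M] in simp)
  qed
qed

section \<open>Action of H, Y, J and of the rotated H\<close>

context sl3_integration
begin

lemma act_U_e: "act lam (U_e i j) v = gt_e lam i j v"
  by (simp only: U_e_def act_gen rho_e_sl3)

lemma act_U_H: "act lam U_H v = gt_e lam 1 1 v - gt_e lam 2 2 v"
  by (simp only: U_H_def act_diff act_U_e)

text \<open>The 2 in \<open>U_Y\<close> is an element of the ring \<open>usl3\<close>, not a scalar;
  2 u is therefore read as u + u, which explains the doubled term.\<close>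

lemma act_U_Y: "act lam U_Y v =
    (1/3) \<cdot> (gt_e lam 1 1 v + gt_e lam 2 2 v - (gt_e lam 3 3 v + gt_e lam 3 3 v))"
  by (simp only: U_Y_def mult_2 act_scale act_diff act_add act_U_e)

lemma act_U_J: "act lam U_J v =
    (1/4) \<cdot> (act lam U_H (act lam U_H v) + (act lam U_H v + act lam U_H v))
    + gt_e lam 2 1 (gt_e lam 1 2 v)"
  by (simp only: U_J_def U_H_def[symmetric] mult_2 power2_eq_square act_scale act_add act_mult act_U_e)

text \<open>J is the Casimir element of the sl_2 spanned by e_12, e_21 and H. With a = l21 - l11 and
  b = l11 - l22 its eigenvalue is ((b - a)^2 + 2 (b - a)) / 4 + a (b + 1) = (a + b) (a + b + 2) /
  4.\<close>

lemma diagonal_action: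
  assumes L: "(l11, l21, l22) \<in> GT_patterns lam"
  defines "M \<equiv> (l11, l21, l22)"
  shows "act lam U_H (xi lam M) = (2 * l11 - l21 - l22) \<cdot> xi lam M"
    "act lam U_Y (xi lam M) = (l21 + l22) \<cdot> xi lam M"
    "act lam U_J (xi lam M) = ((l21 - l22) * (l21 - l22 + 2) / 4) \<cdot> xi lam M"
proof -
  obtain l31 l32 l33 where lam: "lam = (l31, l32, l33)" by (cases lam)
  note act = gt_e_xi[of _ _ _ l31 l32 l33, folded lam]
  note nb = GT_pattern_neighbours[OF L[unfolded lam], folded lam M_def]
  show H: "act lam U_H (xi lam M) = (2 * l11 - l21 - l22) \<cdot> xi lam M"
    unfolding act_U_H M_def act[OF L] by (simp add: fun_eq_iff algebra_simps)
  show "act lam U_Y (xi lam M) = (l21 + l22) \<cdot> xi lam M"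
    unfolding act_U_Y M_def act[OF L] by (simp add: fun_eq_iff algebra_simps)
  have 21: "gt_e lam 2 1 (gt_e lam 1 2 (xi lam M)) = ((l21 - l11) * (l11 - l22 + 1)) \<cdot> xi lam M"
  proof (cases "M + d11 \<in> GT_patterns lam")
    case True
    then show ?thesis
      using act(4)[OF L] act(5)[of "l11 + 1" l21 l22]
      by (simp only: M_def vlinear_vscale[OF vlinear_gt_e] gt_pattern_shifts add_diff_cancel)
  next
    case False
    then have "l21 - l11 = 0" using nb(1) by auto
    then show ?thesis
      using act(4)[OF L]
      by (simp only: M_def mult_zero_left vscale_simps vlinear_0[OF vlinear_gt_e])
  qed
  show "act lam U_J (xi lam M) = ((l21 - l22) * (l21 - l22 + 2) / 4) \<cdot> xi lam M"
    unfolding act_U_J H vlinear_vscale[OF vlinear_act] 21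
    by (auto simp: fun_eq_iff field_simps)
qed

lemma act_Psi_U_H:
  assumes R: "rotation_matrix R"
  shows "act lam (Psi R U_H) v = (\<Sum>k\<in>UNIV. \<Sum>l\<in>UNIV.
    (cmat R $ k $ 1 * cmat R $ l $ 1 - cmat R $ k $ 2 * cmat R $ l $ 2) \<cdot> gt_e lam k l v)"
proof -
  have "Psi R U_H = Psi R (U_e 1 1) - Psi R (U_e 2 2)"
    unfolding U_H_def Psi_def
    by (metis R conj_sl3_hom usl3_map_add add_diff_cancel diff_add_cancel)
  then show ?thesis
    unfolding Psi_e[OF R] act_diff act_sum act_scale act_U_e sum_subtractf[symmetric]
    by (simp only: act_diff act_sum act_scale act_U_e sum_subtractf[symmetric])
       (auto simp: cmat_def fun_eq_iff gt_sum_apply algebra_simps sum_subtractf intro!: sum.cong)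
qed

end

text \<open>Shared by both explicit relations: a and b are the first two columns of S in the
  recurrence and its first two rows in the difference relation, while x is the unshifted matrix
  element.\<close>

lemma quadratic_form_regroup:
  fixes a b :: "3 \<Rightarrow> complex" and e :: "3 \<Rightarrow> 3 \<Rightarrow> complex"
  assumes "e 1 1 = p1 * x" "e 2 2 = p2 * x" "e 3 3 = - p3 * x"
  shows "(\<Sum>k\<in>UNIV. \<Sum>l\<in>UNIV. (a k * a l - b k * b l) * e k l) =
    (((a 1)\<^sup>2 - (b 1)\<^sup>2) * p1 + ((a 2)\<^sup>2 - (b 2)\<^sup>2) * p2 - ((a 3)\<^sup>2 - (b 3)\<^sup>2) * p3) * x
    + (a 1 * a 2 - b 1 * b 2) * (e 1 2 + e 2 1)
    + (a 2 * a 3 - b 2 * b 3) * e 2 3 + (a 3 * a 2 - b 3 * b 2) * e 3 2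
    + (a 1 * a 3 - b 1 * b 3) * e 1 3 + (a 3 * a 1 - b 3 * b 1) * e 3 1"
  by (simp add: sum_3 assms power2_eq_square algebra_simps)

text \<open>Also correct when N is not a pattern: then \<open>xi lam N\<close> and
  \<open>f N\<close> are both 0. This realises the convention that such terms are omitted.\<close>

lemma sum_xi_left:
  assumes "\<And>M. M \<notin> GT_patterns lam \<Longrightarrow> f M = 0"
  shows "(\<Sum>M\<in>GT_patterns lam. xi lam N M * f M) = f N"
proof -
  have "(\<Sum>M\<in>GT_patterns lam. xi lam N M * f M) = (\<Sum>M\<in>GT_patterns lam. if M = N then f N else 0)"
    by (intro sum.cong) (auto simp: xi_def)
  then show ?thesis using assms by (auto simp: finite_GT_patterns)
qed

text \<open>Used when the image index L' is fixed and the sum runs over sources M: only the M that t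
  sends to L' survives. The coefficient is then taken at that source N, not at L', and this produces
  the shifted constants of the difference relation.\<close>

lemma sum_xi_right:
  assumes "\<And>M. M \<notin> GT_patterns lam \<Longrightarrow> f M = 0" "L' \<in> GT_patterns lam" "\<And>M. t M = L' \<longleftrightarrow> M = N"
  shows "(\<Sum>M\<in>GT_patterns lam. c M * xi lam (t M) L' * f M) = c N * f N"
proof -
  have "(\<Sum>M\<in>GT_patterns lam. c M * xi lam (t M) L' * f M)
      = (\<Sum>M\<in>GT_patterns lam. if M = N then c N * f N else 0)"
  proof (intro sum.cong refl)
    fix M
    have "xi lam (t M) L' = (if M = N then 1 else 0)"
      using assms(2) assms(3)[of M] by (cases "M = N") (auto simp: xi_def)
    then show "c M * xi lam (t M) L' * f M = (if M = N then c N * f N else 0)" by simp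
  qed
  then show ?thesis using assms(1) by (auto simp: finite_GT_patterns)
qed

lemma sum_swap_form:
  fixes g :: "3 \<Rightarrow> 3 \<Rightarrow> 'b \<Rightarrow> complex" and c :: "3 \<Rightarrow> 3 \<Rightarrow> complex"
  shows "(\<Sum>M\<in>A. (\<Sum>k\<in>UNIV. \<Sum>l\<in>UNIV. c k l * g k l M) * f M) =
    (\<Sum>k\<in>UNIV. \<Sum>l\<in>UNIV. c k l * (\<Sum>M\<in>A. g k l M * f M))"
  by (simp only: sum_3 sum.distrib distrib_right sum_distrib_left mult.assoc)

theorem mainTheorem3:
  fixes lam :: weight and l31 l32 l33 :: complex
    and S :: "real^3^3" and C :: "complex^3^3"
    and p :: "complex^3^3 \<Rightarrow> gt_vec \<Rightarrow> gt_vec"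
    and \<sigma> :: "gt_vec \<Rightarrow> gt_vec"
    and s :: "gt_pattern \<Rightarrow> gt_pattern \<Rightarrow> complex"
  assumes lam: "lam = (l31, l32, l33)" "highest_weight lam"
    and S: "rotation_matrix S"
    and C: "C = cmat S"
    and p: "integrates lam p"
    and \<sigma>: "\<sigma> = p (cmat (matrix_inv S))"
    and s: "\<And>L. L \<in> GT_patterns lam \<Longrightarrow> \<sigma> (xi lam L) = (\<Sum>L'\<in>GT_patterns lam. s L' L \<cdot> xi lam L')"
    and s0: "\<And>L L'. L \<notin> GT_patterns lam \<or> L' \<notin> GT_patterns lam \<Longrightarrow> s L' L = 0"
  shows
    "(\<forall>(g, ev) \<in> {(U_H, \<lambda>(l11, l21, l22). 2 * l11 - l21 - l22),
                 (U_Y, \<lambda>(l11, l21, l22). l21 + l22),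
                 (U_J, \<lambda>(l11, l21, l22). (l21 - l22) * (l21 - l22 + 2) / 4)}.
        \<forall>L\<in>GT_patterns lam.
          act lam g (xi lam L) = ev L \<cdot> xi lam L \<and>
          \<sigma> (act lam (Psi S g) (xi lam L)) = act lam g (\<sigma> (xi lam L)) \<and>
          \<sigma> (act lam g (xi lam L)) = act lam (Psi (transpose S) g) (\<sigma> (xi lam L)) \<and>
          (\<forall>L'\<in>GT_patterns lam.
            (\<Sum>M\<in>GT_patterns lam. act lam (Psi S g) (xi lam L) M * s L' M) = ev L' * s L' L \<and>
            ev L * s L' L = (\<Sum>M\<in>GT_patterns lam. act lam (Psi (transpose S) g) (xi lam M) L' * s M L)))
    \<and>
    (\<forall>L\<in>GT_patterns lam. \<forall>L'\<in>GT_patterns lam.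
      \<forall>(l11::complex) (l21::complex) (l22::complex) (m11::complex) (m21::complex) (m22::complex).
      L = (l11, l21, l22) \<longrightarrow> L' = (m11, m21, m22) \<longrightarrow>
        (((C$1$1)\<^sup>2 - (C$1$2)\<^sup>2) * l11 + ((C$2$1)\<^sup>2 - (C$2$2)\<^sup>2) * (l21 + l22 - l11)
          - ((C$3$1)\<^sup>2 - (C$3$2)\<^sup>2) * (l21 + l22)) * s L' L
        + (C$1$1 * C$2$1 - C$1$2 * C$2$2) *
            ((l21 - l11) * (l11 - l22 + 1) * s L' (L + d11) + s L' (L - d11))
        + (C$2$1 * C$3$1 - C$2$2 * C$3$2) *
            ((l31 - l21) / (l21 - l22 + 1) * s L' (L + d21)
             + (l31 - l22 + 1) / (l21 - l22 + 1) * s L' (L + d22))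
        + (C$3$1 * C$2$1 - C$3$2 * C$2$2) *
            ((l21 - l32) * (l21 - l33 + 1) * (l21 - l11) / (l21 - l22 + 1) * s L' (L - d21)
             + (l11 - l22 + 1) * (l32 - l22 + 1) * (l22 - l33) / (l21 - l22 + 1) * s L' (L - d22))
        + (C$1$1 * C$3$1 - C$1$2 * C$3$2) *
            ((l11 - l22 + 1) * (l31 - l21) / (l21 - l22 + 1) * s L' (L + d11 + d21)
             - (l21 - l11) * (l31 - l22 + 1) / (l21 - l22 + 1) * s L' (L + d11 + d22))
        + (C$3$1 * C$1$1 - C$3$2 * C$1$2) *
            ((l21 - l32) * (l21 - l33 + 1) / (l21 - l22 + 1) * s L' (L - d11 - d21)
             - (l32 - l22 + 1) * (l22 - l33) / (l21 - l22 + 1) * s L' (L - d11 - d22))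
        = (2 * m11 - m21 - m22) * s L' L)
    \<and>
    (\<forall>L\<in>GT_patterns lam. \<forall>L'\<in>GT_patterns lam.
      \<forall>(l11::complex) (l21::complex) (l22::complex) (m11::complex) (m21::complex) (m22::complex).
      L = (l11, l21, l22) \<longrightarrow> L' = (m11, m21, m22) \<longrightarrow>
        (2 * l11 - l21 - l22) * s L' L =
        (((C$1$1)\<^sup>2 - (C$2$1)\<^sup>2) * m11 + ((C$1$2)\<^sup>2 - (C$2$2)\<^sup>2) * (m21 + m22 - m11)
          - ((C$1$3)\<^sup>2 - (C$2$3)\<^sup>2) * (m21 + m22)) * s L' L
        + (C$1$1 * C$1$2 - C$2$1 * C$2$2) *
            ((m21 - m11 + 1) * (m11 - m22) * s (L' - d11) L + s (L' + d11) L)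
        + (C$1$2 * C$1$3 - C$2$2 * C$2$3) *
            ((l31 - m21 + 1) / (m21 - m22) * s (L' - d21) L
             + (l31 - m22 + 2) / (m21 - m22 + 2) * s (L' - d22) L)
        + (C$1$3 * C$1$2 - C$2$3 * C$2$2) *
            ((m21 - l32 + 1) * (m21 - l33 + 2) * (m21 - m11 + 1) / (m21 - m22 + 2) * s (L' + d21) L
             + (m11 - m22) * (l32 - m22) * (m22 - l33 + 1) / (m21 - m22) * s (L' + d22) L)
        + (C$1$1 * C$1$3 - C$2$1 * C$2$3) *
            ((m11 - m22) * (l31 - m21 + 1) / (m21 - m22) * s (L' - d11 - d21) L
             - (m21 - m11 + 1) * (l31 - m22 + 2) / (m21 - m22 + 2) * s (L' - d11 - d22) L)
        + (C$1$3 * C$1$1 - C$2$3 * C$2$1) *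
            ((m21 - l32 + 1) * (m21 - l33 + 2) / (m21 - m22 + 2) * s (L' + d11 + d21) L
             - (l32 - m22) * (m22 - l33 + 1) / (m21 - m22) * s (L' + d11 + d22) L))"
proof -
  interpret sl3_integration lam p by unfold_locales (rule p)
  let ?P = "GT_patterns lam"
  have lin: "linear_on_V lam \<sigma>"
    unfolding \<sigma> by (rule linear_p[OF rotation_facts(3)[OF S]])
  \<comment> \<open>Holds for all triples: off the patterns both sides are 0, by \<open>s0\<close>
    and the support of \<open>xi\<close>.\<close>
  have \<sigma>_xi: "\<sigma> (xi lam L) M = s M L" for L M
  proof (cases "L \<in> ?P")
    case True
    have "\<sigma> (xi lam L) M = (\<Sum>L'\<in>?P. s L' L * xi lam L' M)"
      unfolding s[OF True] gt_sum_apply vscale_apply ..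
    also have "\<dots> = (\<Sum>L'\<in>?P. if L' = M then s M L else 0)"
      by (intro sum.cong) (auto simp: xi_def)
    finally show ?thesis using s0 by (auto simp: finite_GT_patterns)
  next
    case False
    then show ?thesis
      using s0 by (simp add: xi_notin linear_on_V_0[OF lin])
  qed
  have \<sigma>_expand: "\<sigma> v M = (\<Sum>L\<in>?P. v L * s M L)" if "v \<in> V_space lam" for v M
    unfolding linear_on_V_expand[OF lin that] gt_sum_apply vscale_apply \<sigma>_xi ..
  have rec: "\<sigma> (act lam (Psi S g) v) = act lam g (\<sigma> v)" if "v \<in> V_space lam" for g v
    unfolding \<sigma> by (rule p_act_recurrence[OF S that])
  have dif: "\<sigma> (act lam g v) = act lam (Psi (transpose S) g) (\<sigma> v)" if "v \<in> V_space lam" for g v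
    unfolding \<sigma> by (rule p_act_difference[OF S that])
  have act_\<sigma>: "act lam g (\<sigma> (xi lam L)) M = (\<Sum>N\<in>?P. act lam g (xi lam N) M * s N L)" for g L M
  proof -
    have "linear_on_V lam (act lam g)"
      using vlinear_act[of g] act_in_V[of _ g] unfolding linear_on_V_def vlinear_def by blast
    moreover have "\<sigma> (xi lam L) \<in> V_space lam"
      using lin unfolding linear_on_V_def by simp
    ultimately have "act lam g (\<sigma> (xi lam L)) = (\<Sum>N\<in>?P. s N L \<cdot> act lam g (xi lam N))"
      unfolding \<sigma>_xi[symmetric] by (rule linear_on_V_expand)
    then show ?thesis
      by (simp only: gt_sum_apply vscale_apply mult.commute)
  qed
  \<comment> \<open>Coordinate L' of the two operator identities; on the side where g acts
    diagonally the sum collapses to one term.\<close>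
  have matrix_elements:
    "(\<Sum>M\<in>?P. act lam (Psi S g) (xi lam L) M * s L' M) = ev L' * s L' L"
    "ev L * s L' L = (\<Sum>M\<in>?P. act lam (Psi (transpose S) g) (xi lam M) L' * s M L)"
    if diag: "\<And>L. L \<in> ?P \<Longrightarrow> act lam g (xi lam L) = ev L \<cdot> xi lam L" and LL': "L \<in> ?P" "L' \<in> ?P"
    for g ev L L'
  proof -
    have "(\<Sum>M\<in>?P. act lam (Psi S g) (xi lam L) M * s L' M) = act lam g (\<sigma> (xi lam L)) L'"
      unfolding rec[OF V_space_xi, symmetric] by (rule \<sigma>_expand[symmetric]) (simp add: act_in_V)
    also have "\<dots> = (\<Sum>N\<in>?P. ev N * xi lam N L' * s N L)"
      unfolding act_\<sigma> by (intro sum.cong) (simp_all only: diag vscale_apply)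
    also have "\<dots> = ev L' * s L' L"
      by (rule sum_xi_right) (use s0 LL' in auto)
    finally show "(\<Sum>M\<in>?P. act lam (Psi S g) (xi lam L) M * s L' M) = ev L' * s L' L" .
    have "ev L * s L' L = \<sigma> (act lam g (xi lam L)) L'"
      using lin unfolding diag[OF LL'(1)] linear_on_V_def by (simp only: V_space_xi vscale_apply \<sigma>_xi)
    then show "ev L * s L' L = (\<Sum>M\<in>?P. act lam (Psi (transpose S) g) (xi lam M) L' * s M L)"
      unfolding dif[OF V_space_xi] act_\<sigma> .
  qed
  have S': "rotation_matrix (transpose S)"
    using S by (simp add: rotation_matrix_def)
  define evH :: "gt_pattern \<Rightarrow> complex" where "evH = (\<lambda>(l11, l21, l22). 2 * l11 - l21 - l22)"
  define evY :: "gt_pattern \<Rightarrow> complex" where "evY = (\<lambda>(l11, l21, l22). l21 + l22)"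
  define evJ :: "gt_pattern \<Rightarrow> complex" where
    "evJ = (\<lambda>(l11, l21, l22). (l21 - l22) * (l21 - l22 + 2) / 4)"
  have diag: "act lam U_H (xi lam L) = evH L \<cdot> xi lam L" "act lam U_Y (xi lam L) = evY L \<cdot> xi lam L"
    "act lam U_J (xi lam L) = evJ L \<cdot> xi lam L" if "L \<in> ?P" for L
    using diagonal_action[of "fst L" "fst (snd L)" "snd (snd L)"] that
    by (simp_all only: evH_def evY_def evJ_def split_beta prod.collapse)
  have part1: "\<forall>(g, ev) \<in> {(U_H, evH), (U_Y, evY), (U_J, evJ)}.
        \<forall>L\<in>?P.
          act lam g (xi lam L) = ev L \<cdot> xi lam L \<and>
          \<sigma> (act lam (Psi S g) (xi lam L)) = act lam g (\<sigma> (xi lam L)) \<and>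
          \<sigma> (act lam g (xi lam L)) = act lam (Psi (transpose S) g) (\<sigma> (xi lam L)) \<and>
          (\<forall>L'\<in>?P.
            (\<Sum>M\<in>?P. act lam (Psi S g) (xi lam L) M * s L' M) = ev L' * s L' L \<and>
            ev L * s L' L = (\<Sum>M\<in>?P. act lam (Psi (transpose S) g) (xi lam M) L' * s M L))"
    (is "\<forall>(g, ev) \<in> _. ?Q g ev")
  proof -
    have "?Q g ev" if "\<And>L. L \<in> ?P \<Longrightarrow> act lam g (xi lam L) = ev L \<cdot> xi lam L" for g ev
      using rec[OF V_space_xi] dif[OF V_space_xi] matrix_elements[of g ev, OF that] that by blast
    note Q = this
    have "?Q U_H evH" "?Q U_Y evY" "?Q U_J evJ" by (rule Q, rule diag, assumption)+
    then show ?thesis by (simp only: ball_simps prod.case simp_thms)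
  qed
  have part2: "
        (((C$1$1)\<^sup>2 - (C$1$2)\<^sup>2) * l11 + ((C$2$1)\<^sup>2 - (C$2$2)\<^sup>2) * (l21 + l22 - l11)
          - ((C$3$1)\<^sup>2 - (C$3$2)\<^sup>2) * (l21 + l22)) * s L' L
        + (C$1$1 * C$2$1 - C$1$2 * C$2$2) *
            ((l21 - l11) * (l11 - l22 + 1) * s L' (L + d11) + s L' (L - d11))
        + (C$2$1 * C$3$1 - C$2$2 * C$3$2) *
            ((l31 - l21) / (l21 - l22 + 1) * s L' (L + d21)
             + (l31 - l22 + 1) / (l21 - l22 + 1) * s L' (L + d22))
        + (C$3$1 * C$2$1 - C$3$2 * C$2$2) *
            ((l21 - l32) * (l21 - l33 + 1) * (l21 - l11) / (l21 - l22 + 1) * s L' (L - d21)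
             + (l11 - l22 + 1) * (l32 - l22 + 1) * (l22 - l33) / (l21 - l22 + 1) * s L' (L - d22))
        + (C$1$1 * C$3$1 - C$1$2 * C$3$2) *
            ((l11 - l22 + 1) * (l31 - l21) / (l21 - l22 + 1) * s L' (L + d11 + d21)
             - (l21 - l11) * (l31 - l22 + 1) / (l21 - l22 + 1) * s L' (L + d11 + d22))
        + (C$3$1 * C$1$1 - C$3$2 * C$1$2) *
            ((l21 - l32) * (l21 - l33 + 1) / (l21 - l22 + 1) * s L' (L - d11 - d21)
             - (l32 - l22 + 1) * (l22 - l33) / (l21 - l22 + 1) * s L' (L - d11 - d22))
        = (2 * m11 - m21 - m22) * s L' L"
    if L: "L \<in> ?P" and L': "L' \<in> ?P" and eqs: "L = (l11, l21, l22)" "L' = (m11, m21, m22)"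
    for L L' l11 l21 l22 m11 m21 m22
  proof -
    \<comment> \<open>Here e_kl acts before \<sigma>, so it shifts the second index of
      \<open>s\<close> and its coefficients are taken at L.\<close>
    define E where "E k l = (\<Sum>M\<in>?P. gt_e lam k l (xi lam L) M * s L' M)" for k l
    have Lm: "(l11, l21, l22) \<in> GT_patterns (l31, l32, l33)" using L by (simp only: eqs lam(1))
    note e = gt_e_xi[OF Lm, folded eqs lam(1)] gt13_xi[OF Lm, folded eqs lam(1)]
      gt31_xi[OF Lm, folded eqs lam(1)]
    have pair: "(\<Sum>M\<in>?P. xi lam N M * s L' M) = s L' N" for N
      by (rule sum_xi_left) (use s0 in blast)
    have "(\<Sum>k\<in>UNIV. \<Sum>l\<in>UNIV. (C $ k $ 1 * C $ l $ 1 - C $ k $ 2 * C $ l $ 2) * E k l)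
        = evH L' * s L' L"
      using matrix_elements(1)[OF diag(1) L L']
      unfolding act_Psi_U_H[OF S] gt_sum_apply vscale_apply sum_swap_form E_def C .
    moreover have "E 1 1 = l11 * s L' L" "E 2 2 = (l21 + l22 - l11) * s L' L"
      "E 3 3 = - (l21 + l22) * s L' L"
      by (simp_all only: E_def e vscale_apply mult.assoc sum_distrib_left[symmetric] pair)
    note quadratic_form_regroup[where e = E, OF this]
    moreover have "E 1 2 = (l21 - l11) * (l11 - l22 + 1) * s L' (L + d11)" "E 2 1 = s L' (L - d11)"
      "E 2 3 = (l31 - l21) / (l21 - l22 + 1) * s L' (L + d21)
             + (l31 - l22 + 1) / (l21 - l22 + 1) * s L' (L + d22)"
      "E 3 2 = (l21 - l32) * (l21 - l33 + 1) * (l21 - l11) / (l21 - l22 + 1) * s L' (L - d21)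
             + (l11 - l22 + 1) * (l32 - l22 + 1) * (l22 - l33) / (l21 - l22 + 1) * s L' (L - d22)"
      "E 1 3 = (l11 - l22 + 1) * (l31 - l21) / (l21 - l22 + 1) * s L' (L + d11 + d21)
             - (l21 - l11) * (l31 - l22 + 1) / (l21 - l22 + 1) * s L' (L + d11 + d22)"
      "E 3 1 = (l21 - l32) * (l21 - l33 + 1) / (l21 - l22 + 1) * s L' (L - d11 - d21)
             - (l32 - l22 + 1) * (l22 - l33) / (l21 - l22 + 1) * s L' (L - d11 - d22)"
      unfolding E_def e
      by (simp_all only: plus_fun_apply minus_apply vscale_apply distrib_right left_diff_distrib
          mult.assoc sum.distrib sum_subtractf sum_distrib_left[symmetric] pair)
    ultimately show ?thesis
      by (simp only: evH_def eqs(2) prod.case)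
  qed
  \<comment> \<open>The denominator m21 - m22 may be 0, and division then yields 0. This agrees with
    omitting the terms: the shifts of L' in those terms lower m21 or raise m22, so the result cannot
    interlace and its \<open>s\<close> is 0 too.\<close>
  have part3: "
        (2 * l11 - l21 - l22) * s L' L =
        (((C$1$1)\<^sup>2 - (C$2$1)\<^sup>2) * m11 + ((C$1$2)\<^sup>2 - (C$2$2)\<^sup>2) * (m21 + m22 - m11)
          - ((C$1$3)\<^sup>2 - (C$2$3)\<^sup>2) * (m21 + m22)) * s L' L
        + (C$1$1 * C$1$2 - C$2$1 * C$2$2) *
            ((m21 - m11 + 1) * (m11 - m22) * s (L' - d11) L + s (L' + d11) L)
        + (C$1$2 * C$1$3 - C$2$2 * C$2$3) *
            ((l31 - m21 + 1) / (m21 - m22) * s (L' - d21) L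
             + (l31 - m22 + 2) / (m21 - m22 + 2) * s (L' - d22) L)
        + (C$1$3 * C$1$2 - C$2$3 * C$2$2) *
            ((m21 - l32 + 1) * (m21 - l33 + 2) * (m21 - m11 + 1) / (m21 - m22 + 2) * s (L' + d21) L
             + (m11 - m22) * (l32 - m22) * (m22 - l33 + 1) / (m21 - m22) * s (L' + d22) L)
        + (C$1$1 * C$1$3 - C$2$1 * C$2$3) *
            ((m11 - m22) * (l31 - m21 + 1) / (m21 - m22) * s (L' - d11 - d21) L
             - (m21 - m11 + 1) * (l31 - m22 + 2) / (m21 - m22 + 2) * s (L' - d11 - d22) L)
        + (C$1$3 * C$1$1 - C$2$3 * C$2$1) *
            ((m21 - l32 + 1) * (m21 - l33 + 2) / (m21 - m22 + 2) * s (L' + d11 + d21) L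
             - (l32 - m22) * (m22 - l33 + 1) / (m21 - m22) * s (L' + d11 + d22) L)"
    if L: "L \<in> ?P" and L': "L' \<in> ?P" and eqs: "L = (l11, l21, l22)" "L' = (m11, m21, m22)"
    for L L' l11 l21 l22 m11 m21 m22
  proof -
    \<comment> \<open>Now e_kl acts after \<sigma>, so the sum runs over the patterns M from which
      e_kl reaches L'.\<close>
    define E where "E k l = (\<Sum>M\<in>?P. gt_e lam k l (xi lam M) L' * s M L)" for k l
    have E_cong: "E k l = (\<Sum>M\<in>?P. f M * s M L)"
      if "\<And>a b c. (a, b, c) \<in> ?P \<Longrightarrow> gt_e lam k l (xi lam (a, b, c)) L' = f (a, b, c)" for k l f
      unfolding E_def by (intro sum.cong refl) (metis that prod.exhaust)
    note e = gt_e_xi[of _ _ _ l31 l32 l33, folded lam(1)] gt13_xi[of _ _ _ l31 l32 l33, folded lam(1)]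
      gt31_xi[of _ _ _ l31 l32 l33, folded lam(1)]
    have pair: "(\<Sum>M\<in>?P. c M * xi lam (t M) L' * s M L) = c N * s N L"
      if "\<And>M. t M = L' \<longleftrightarrow> M = N" for c t N
      by (rule sum_xi_right[OF _ L' that]) (use s0 in blast)
    have norm: "x - (y - 1) = x - y + 1" "x - 1 - y = x - y - 1" "x + 1 - y = x - y + 1"
      "x - (y + 1) = x - y - 1" "x - 1 + 1 = x" "x + 1 + 1 = x + 2" for x y :: complex
      by simp_all
    \<comment> \<open>Solves for the unique source of L'. Substituting it into the coefficients
      turns, for instance, b - c + 1 into m21 - m22 for a raising of l21 and into m21 - m22 + 2 for
      a lowering.\<close>
    have shift: "\<And>M. M + d = L' \<longleftrightarrow> M = L' - d" "\<And>M. M - d = L' \<longleftrightarrow> M = L' + d"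
      "\<And>M. M + d + d' = L' \<longleftrightarrow> M = L' - d - d'" "\<And>M. M - d - d' = L' \<longleftrightarrow> M = L' + d + d'"
      for d d'
      by (auto simp: algebra_simps)
    have pair2: "(\<Sum>M\<in>?P. (c M * xi lam (t M) L' + c' M * xi lam (t' M) L') * s M L)
        = c N * s N L + c' N' * s N' L"
      "(\<Sum>M\<in>?P. (c M * xi lam (t M) L' - c' M * xi lam (t' M) L') * s M L)
        = c N * s N L - c' N' * s N' L"
      if "\<And>M. t M = L' \<longleftrightarrow> M = N" "\<And>M. t' M = L' \<longleftrightarrow> M = N'" for c t N c' t' N'
      by (simp_all only: distrib_right left_diff_distrib sum.distrib sum_subtractf
          pair[OF that(1)] pair[OF that(2)])
    have "(\<Sum>k\<in>UNIV. \<Sum>l\<in>UNIV. (C $ 1 $ k * C $ 1 $ l - C $ 2 $ k * C $ 2 $ l) * E k l)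
        = evH L * s L' L"
    proof -
      have "cmat (transpose S) $ i $ j = C $ j $ i" for i j
        by (simp add: C cmat_def transpose_def)
      then show ?thesis
        using matrix_elements(2)[OF diag(1) L L']
        unfolding act_Psi_U_H[OF S'] gt_sum_apply vscale_apply sum_swap_form E_def by simp
    qed
    moreover have "E 1 1 = m11 * s L' L" "E 2 2 = (m21 + m22 - m11) * s L' L"
      "E 3 3 = - (m21 + m22) * s L' L"
    proof -
      have "E 1 1 = (\<Sum>M\<in>?P. (\<lambda>(a, b, c). a) M * xi lam M L' * s M L)"
        "E 2 2 = (\<Sum>M\<in>?P. (\<lambda>(a, b, c). b + c - a) M * xi lam M L' * s M L)"
        "E 3 3 = (\<Sum>M\<in>?P. (\<lambda>(a, b, c). - (b + c)) M * xi lam M L' * s M L)"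
        by (rule E_cong; simp only: e vscale_apply prod.case)+
      then show "E 1 1 = m11 * s L' L" "E 2 2 = (m21 + m22 - m11) * s L' L"
        "E 3 3 = - (m21 + m22) * s L' L"
        using pair[where t = "\<lambda>M. M" and N = L'] by (simp_all only: eqs(2) prod.case simp_thms)
    qed
    note quadratic_form_regroup[where e = E, OF this]
    moreover have "E 1 2 = (m21 - m11 + 1) * (m11 - m22) * s (L' - d11) L"
    proof -
      have "E 1 2 = (\<Sum>M\<in>?P. (\<lambda>(a, b, c). (b - a) * (a - c + 1)) M * xi lam (M + d11) L' * s M L)"
        by (rule E_cong; simp only: e vscale_apply prod.case)
      then show ?thesis
        unfolding pair[OF shift(1)] by (simp only: eqs(2) gt_pattern_shifts prod.case norm)
    qed
    moreover have "E 2 1 = s (L' + d11) L"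
    proof -
      have "E 2 1 = (\<Sum>M\<in>?P. (\<lambda>M. 1) M * xi lam (M - d11) L' * s M L)"
        by (rule E_cong; simp only: e mult_1)
      then show ?thesis unfolding pair[OF shift(2)] by simp
    qed
    moreover have "E 2 3 = (l31 - m21 + 1) / (m21 - m22) * s (L' - d21) L
             + (l31 - m22 + 2) / (m21 - m22 + 2) * s (L' - d22) L"
    proof -
      have "E 2 3 = (\<Sum>M\<in>?P. ((\<lambda>(a, b, c). (l31 - b) / (b - c + 1)) M * xi lam (M + d21) L'
          + (\<lambda>(a, b, c). (l31 - c + 1) / (b - c + 1)) M * xi lam (M + d22) L') * s M L)"
        by (rule E_cong; simp only: e plus_fun_apply vscale_apply prod.case)
      then show ?thesis
        unfolding pair2(1)[OF shift(1) shift(1)]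
        by (simp only: eqs(2) gt_pattern_shifts prod.case norm)
    qed
    moreover have "E 3 2 =
        (m21 - l32 + 1) * (m21 - l33 + 2) * (m21 - m11 + 1) / (m21 - m22 + 2) * s (L' + d21) L
        + (m11 - m22) * (l32 - m22) * (m22 - l33 + 1) / (m21 - m22) * s (L' + d22) L"
    proof -
      have "E 3 2 = (\<Sum>M\<in>?P. ((\<lambda>(a, b, c). (b - l32) * (b - l33 + 1) * (b - a) / (b - c + 1)) M
            * xi lam (M - d21) L'
          + (\<lambda>(a, b, c). (a - c + 1) * (l32 - c + 1) * (c - l33) / (b - c + 1)) M
            * xi lam (M - d22) L') * s M L)"
        by (rule E_cong; simp only: e plus_fun_apply vscale_apply prod.case)
      then show ?thesis
        unfolding pair2(1)[OF shift(2) shift(2)]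
        by (simp only: eqs(2) gt_pattern_shifts prod.case norm)
    qed
    moreover have "E 1 3 = (m11 - m22) * (l31 - m21 + 1) / (m21 - m22) * s (L' - d11 - d21) L
             - (m21 - m11 + 1) * (l31 - m22 + 2) / (m21 - m22 + 2) * s (L' - d11 - d22) L"
    proof -
      have "E 1 3 = (\<Sum>M\<in>?P. ((\<lambda>(a, b, c). (a - c + 1) * (l31 - b) / (b - c + 1)) M
            * xi lam (M + d11 + d21) L'
          - (\<lambda>(a, b, c). (b - a) * (l31 - c + 1) / (b - c + 1)) M
            * xi lam (M + d11 + d22) L') * s M L)"
        by (rule E_cong; simp only: e minus_apply vscale_apply prod.case)
      then show ?thesis
        unfolding pair2(2)[OF shift(3) shift(3)]
        by (simp only: eqs(2) gt_pattern_shifts prod.case norm)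
    qed
    moreover have "E 3 1 = (m21 - l32 + 1) * (m21 - l33 + 2) / (m21 - m22 + 2) * s (L' + d11 + d21) L
             - (l32 - m22) * (m22 - l33 + 1) / (m21 - m22) * s (L' + d11 + d22) L"
    proof -
      have "E 3 1 = (\<Sum>M\<in>?P. ((\<lambda>(a, b, c). (b - l32) * (b - l33 + 1) / (b - c + 1)) M
            * xi lam (M - d11 - d21) L'
          - (\<lambda>(a, b, c). (l32 - c + 1) * (c - l33) / (b - c + 1)) M
            * xi lam (M - d11 - d22) L') * s M L)"
        by (rule E_cong; simp only: e minus_apply vscale_apply prod.case)
      then show ?thesis
        unfolding pair2(2)[OF shift(4) shift(4)]
        by (simp only: eqs(2) gt_pattern_shifts prod.case norm)
    qed
    ultimately show ?thesis
      by (simp only: evH_def eqs(1) prod.case)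
  qed
  show ?thesis
    using part1[unfolded evH_def evY_def evJ_def] part2 part3 by blast
qed

end
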